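(* Let $n\ge 2$, $1\le d\le n-1$ and $s\in\mathbb R$. Let $w:\mathbb Z^n\times\mathbf{Gr}(d,n)\to(0,\infty)$ be a weight function such that $w(\cdot,A)$ is at most of polynomial decay for each fixed $A\in\mathbf{Gr}(d,n)$, and suppose that there exists $C_w>0$ such that $$\sum_{A\in\Omega_k}w(k,A)^2\le C_w^2,\qquad \Omega_k:=\{A\in\mathbf{Gr}(d,n): k\perp A\},$$ for every $k\in\mathbb Z^n$. Then the adjoint of $R_d:H^s(\mathbb T^n)\to L^{2,2}_s(X_{d,n};w)$ is given by $$\widehat{R_d^*g}(k)=\sum_{A\in\Omega_k}w(k,A)^2\,\hat g(k,A),$$ and the normal operator $R_d^*R_d:H^s(\mathbb T^n)\to H^s(\mathbb T^n)$ is the Fourier multiplier with symbol $W_k:=\sum_{A\in\Omega_k}w(k,A)^2$. In particular, the mapping $F_{W_k^{-1}}R_d^*:R_d(\mathcal T')\to\mathcal T'$ is the inverse of $R_d$.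
   Context: $\mathbb T^n=\mathbb R^n/\mathbb Z^n$, $\mathcal T=C^\infty(\mathbb T^n)$, and $\mathcal T'$ is the space of distributions on $\mathbb T^n$, with Fourier coefficients $\hat f(k)=f(e^{-2\pi i k\cdot x})$, $k\in\mathbb Z^n$. $\langle k\rangle=(1+|k|^2)^{1/2}$. $H^s(\mathbb T^n)$ is the space of $f\in\mathcal T'$ with finite norm $\|f\|_{H^s}=(\sum_{k\in\mathbb Z^n}\langle k\rangle^{2s}|\hat f(k)|^2)^{1/2}$. For a function $\omega$ on $\mathbb Z^n$, $F_\omega$ denotes the Fourier multiplier $\widehat{F_\omega f}(k)=\omega(k)\hat f(k)$; thus $F_{W_k^{-1}}$ has symbol $k\mapsto W_k^{-1}$. $\mathbf{Gr}(d,n)$ is the collection of $d$-dimensional linear subspaces of $\mathbb Q^n$, and $k\perp A$ means $k$ is orthogonal to every vector of $A$. For $A\in\mathbf{Gr}(d,n)$ with a basis of integer vectors $v_1,\dots,v_d\in\mathbb Z^n$, the $d$-plane Radon transform of $f\in\mathcal T$ is $$R_df(x,A)=R_{d,A}f(x)=\int_{[0,1]^d}f(x+t_1v_1+\cdots+t_dv_d)\,dt_1\cdots dt_d,$$ which does not depend on the choice of integer basis of $A$. For $f\in\mathcal T'$, $R_{d,A}f\in\mathcal T'$ is defined by duality (using that $R_{d,A}:\mathcal T\to\mathcal T$ is formally $L^2$ self-adjoint), and $R_df$ is the family $A\mapsto R_df(\cdot,A)=R_{d,A}f$. $X_{d,n}=\mathbb T^n\times\mathbf{Gr}(d,n)$.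 A function $\omega:\mathbb Z^n\to(0,\infty)$ is at most of polynomial decay if there are $C,N>0$ with $\omega(k)\ge C\langle k\rangle^{-N}$ for all $k$. $L^{2,2}_s(X_{d,n};w)$ is the Hilbert space of families $g$ with $g(\cdot,A)\in\mathcal T'$ for each $A\in\mathbf{Gr}(d,n)$ and finite norm $$\|g\|^2_{L^{2,2}_s(X_{d,n};w)}=\sum_{A\in\mathbf{Gr}(d,n)}\sum_{k\in\mathbb Z^n}w(k,A)^2\langle k\rangle^{2s}|\hat g(k,A)|^2,$$ with the corresponding inner product, where $\hat g(k,A)$ is the $k$-th Fourier coefficient of $g(\cdot,A)$. On $R_d(\mathcal T')$, $R_d^*$ is defined by the stated Fourier coefficient formula. *)

theory Defs
  imports "HOL-Analysis.Analysis"
begin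

text \<open>Functions on the torus are rendered as \<open>\<int>\<^sup>n\<close>-periodic functions on \<open>\<real>\<^sup>n\<close>.\<close>

definition rvec :: "int^'n \<Rightarrow> real^'n" where
  "rvec k = (\<chi> i. real_of_int (k $ i))"

definition qvec :: "int^'n \<Rightarrow> rat^'n" where
  "qvec k = (\<chi> i. rat_of_int (k $ i))"

definition partial :: "'n::finite \<Rightarrow> (real^'n \<Rightarrow> complex) \<Rightarrow> (real^'n \<Rightarrow> complex)" where
  "partial i f = (\<lambda>x. frechet_derivative f (at x) (axis i 1))"

definition partials :: "'n::finite list \<Rightarrow> (real^'n \<Rightarrow> complex) \<Rightarrow> (real^'n \<Rightarrow> complex)" where
  "partials js f = foldr partial js f"

text \<open>Differentiability of every iterated partial derivative is equivalent to existence and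
  continuity of all of them, that is, to \<open>C\<^sup>\<infinity>\<close>.\<close>

definition smooth :: "(real^'n::finite \<Rightarrow> complex) \<Rightarrow> bool" where
  "smooth f \<longleftrightarrow> (\<forall>js x. partials js f differentiable (at x))"

definition test_functions :: "(real^'n::finite \<Rightarrow> complex) set" where
  "test_functions = {f. smooth f \<and> (\<forall>x k. f (x + rvec k) = f x)}"

definition CN_norm :: "nat \<Rightarrow> (real^'n::finite \<Rightarrow> complex) \<Rightarrow> real" where
  "CN_norm N f = (SUP (js, x) \<in> {js. length js \<le> N} \<times> UNIV. cmod (partials js f x))"

text \<open>Distributions are complex linear (not antilinear) functionals; they are extensional on the
  test functions so that equality in HOL is equality of distributions.\<close>

type_synonym 'n distr = "(real^'n \<Rightarrow> complex) \<Rightarrow> complex"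

definition distributions :: "'n::finite distr set" where
  "distributions = {u \<in> extensional test_functions.
     (\<forall>f\<in>test_functions. \<forall>g\<in>test_functions. u (\<lambda>x. f x + g x) = u f + u g) \<and>
     (\<forall>c. \<forall>f\<in>test_functions. u (\<lambda>x. c * f x) = c * u f) \<and>
     (\<exists>C N. \<forall>f\<in>test_functions. cmod (u f) \<le> C * CN_norm N f)}"

definition fcoeff :: "'n::finite distr \<Rightarrow> int^'n \<Rightarrow> complex" where
  "fcoeff u k = u (\<lambda>x. exp (- 2 * complex_of_real pi * \<i> * complex_of_real (rvec k \<bullet> x)))"

definition jbracket :: "int^'n::finite \<Rightarrow> real" where
  "jbracket k = sqrt (1 + (norm (rvec k))\<^sup>2)"

text \<open>The distribution, if there is one, with Fourier coefficients \<open>\<omega> k * fcoeff u k\<close>; it is unique,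
  since distributions on the torus are determined by their Fourier coefficients.\<close>

definition fourier_multiplier ::
    "(int^'n::finite \<Rightarrow> complex) \<Rightarrow> 'n distr \<Rightarrow> 'n distr" where
  "fourier_multiplier \<omega> u =
     (THE v. v \<in> distributions \<and> (\<forall>k. fcoeff v k = \<omega> k * fcoeff u k))"

definition sobolev :: "real \<Rightarrow> 'n::finite distr set" where
  "sobolev s = {u \<in> distributions.
     (\<lambda>k. jbracket k powr (2 * s) * (cmod (fcoeff u k))\<^sup>2) summable_on UNIV}"

definition sobolev_inner :: "real \<Rightarrow> 'n::finite distr \<Rightarrow> 'n distr \<Rightarrow> complex" where
  "sobolev_inner s u v =
     (\<Sum>\<^sub>\<infinity>k. complex_of_real (jbracket k powr (2 * s)) * fcoeff u k * cnj (fcoeff v k))"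

definition sobolev_norm :: "real \<Rightarrow> 'n::finite distr \<Rightarrow> real" where
  "sobolev_norm s u = sqrt (\<Sum>\<^sub>\<infinity>k. jbracket k powr (2 * s) * (cmod (fcoeff u k))\<^sup>2)"

definition Gr :: "nat \<Rightarrow> (rat^'n::finite) set set" where
  "Gr d = {A. vec.subspace A \<and> vec.dim A = d}"

definition perp :: "int^'n::finite \<Rightarrow> (rat^'n) set \<Rightarrow> bool" where
  "perp k A \<longleftrightarrow> (\<forall>v\<in>A. (\<Sum>i\<in>UNIV. rat_of_int (k $ i) * v $ i) = 0)"

definition Omega :: "nat \<Rightarrow> int^'n::finite \<Rightarrow> (rat^'n) set set" where
  "Omega d k = {A \<in> Gr d. perp k A}"

definition integer_basis :: "nat \<Rightarrow> (rat^'n::finite) set \<Rightarrow> (nat \<Rightarrow> int^'n) \<Rightarrow> bool" where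
  "integer_basis d A v \<longleftrightarrow>
     inj_on (\<lambda>i. qvec (v i)) {..<d} \<and>
     vec.independent ((\<lambda>i. qvec (v i)) ` {..<d}) \<and>
     vec.span ((\<lambda>i. qvec (v i)) ` {..<d}) = A"

text \<open>On test functions the value does not depend on the chosen integer basis of \<open>A\<close>.\<close>

definition radon_fun ::
    "nat \<Rightarrow> (rat^'n::finite) set \<Rightarrow> (real^'n \<Rightarrow> complex) \<Rightarrow> (real^'n \<Rightarrow> complex)" where
  "radon_fun d A f = (\<lambda>x.
     let v = (SOME v. integer_basis d A v) in
       (LINT t : ({..<d} \<rightarrow>\<^sub>E {0..1}) | (\<Pi>\<^sub>M i\<in>{..<d}. lborel).
          f (x + (\<Sum>i<d. t i *\<^sub>R rvec (v i)))))"

definition radon_distr :: "nat \<Rightarrow> (rat^'n::finite) set \<Rightarrow> 'n distr \<Rightarrow> 'n distr" where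
  "radon_distr d A u = (\<lambda>f\<in>test_functions. u (radon_fun d A f))"

definition radon :: "nat \<Rightarrow> 'n::finite distr \<Rightarrow> ((rat^'n) set \<Rightarrow> 'n distr)" where
  "radon d u = (\<lambda>A\<in>Gr d. radon_distr d A u)"

definition poly_decay :: "(int^'n::finite \<Rightarrow> real) \<Rightarrow> bool" where
  "poly_decay \<omega> \<longleftrightarrow> (\<exists>C>0. \<exists>N>0. \<forall>k. \<omega> k \<ge> C * jbracket k powr (- N))"

text \<open>For the nonnegative terms of the norm, summation over pairs \<open>(A, k)\<close> and iterated
  summation (with values in \<open>[0, \<infinity>]\<close>) agree.\<close>

definition L22 ::
    "nat \<Rightarrow> real \<Rightarrow> (int^'n::finite \<Rightarrow> (rat^'n) set \<Rightarrow> real) \<Rightarrow> ((rat^'n) set \<Rightarrow> 'n distr) set" where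
  "L22 d s w = {g \<in> Gr d \<rightarrow>\<^sub>E distributions.
     (\<lambda>(A, k). (w k A)\<^sup>2 * jbracket k powr (2 * s) * (cmod (fcoeff (g A) k))\<^sup>2)
       summable_on (Gr d \<times> UNIV)}"

definition L22_inner ::
    "nat \<Rightarrow> real \<Rightarrow> (int^'n::finite \<Rightarrow> (rat^'n) set \<Rightarrow> real) \<Rightarrow>
     ((rat^'n) set \<Rightarrow> 'n distr) \<Rightarrow> ((rat^'n) set \<Rightarrow> 'n distr) \<Rightarrow> complex" where
  "L22_inner d s w g h =
     (\<Sum>\<^sub>\<infinity>(A, k)\<in>Gr d \<times> UNIV. complex_of_real ((w k A)\<^sup>2 * jbracket k powr (2 * s)) *
        fcoeff (g A) k * cnj (fcoeff (h A) k))"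

definition L22_norm ::
    "nat \<Rightarrow> real \<Rightarrow> (int^'n::finite \<Rightarrow> (rat^'n) set \<Rightarrow> real) \<Rightarrow> ((rat^'n) set \<Rightarrow> 'n distr) \<Rightarrow> real" where
  "L22_norm d s w g =
     sqrt (\<Sum>\<^sub>\<infinity>(A, k)\<in>Gr d \<times> UNIV.
       (w k A)\<^sup>2 * jbracket k powr (2 * s) * (cmod (fcoeff (g A) k))\<^sup>2)"

text \<open>\<open>S\<close> is the adjoint of \<open>T : H \<rightarrow> K\<close>: for each \<open>g\<close> in \<open>K\<close>, \<open>S g\<close> is the one and only
  \<open>h\<close> in \<open>H\<close> that represents \<open>f \<mapsto> \<langle>T f, g\<rangle>\<close>.\<close>

definition is_adjoint ::
    "'a set \<Rightarrow> ('a \<Rightarrow> 'a \<Rightarrow> complex) \<Rightarrow> 'b set \<Rightarrow> ('b \<Rightarrow> 'b \<Rightarrow> complex) \<Rightarrow>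
     ('a \<Rightarrow> 'b) \<Rightarrow> ('b \<Rightarrow> 'a) \<Rightarrow> bool" where
  "is_adjoint H ipH K ipK T S \<longleftrightarrow>
     T \<in> H \<rightarrow> K \<and>
     (\<forall>g\<in>K. \<forall>h. (h \<in> H \<and> (\<forall>f\<in>H. ipK (T f) g = ipH f h)) \<longleftrightarrow> h = S g)"

text \<open>The distribution, if there is one, given by the Fourier coefficient formula for
  \<open>R\<^sub>d\<^sup>*\<close>; convergence of the series over \<open>\<Omega>\<^sub>k\<close> is part of the requirement.\<close>

definition radon_star ::
    "nat \<Rightarrow> (int^'n::finite \<Rightarrow> (rat^'n) set \<Rightarrow> real) \<Rightarrow> ((rat^'n) set \<Rightarrow> 'n distr) \<Rightarrow> 'n distr" where
  "radon_star d w g = (THE u. u \<in> distributions \<and>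
     (\<forall>k. ((\<lambda>A. complex_of_real ((w k A)\<^sup>2) * fcoeff (g A) k) has_sum fcoeff u k) (Omega d k)))"

definition W :: "nat \<Rightarrow> (int^'n::finite \<Rightarrow> (rat^'n) set \<Rightarrow> real) \<Rightarrow> int^'n \<Rightarrow> real" where
  "W d w k = (\<Sum>\<^sub>\<infinity>A\<in>Omega d k. (w k A)\<^sup>2)"

end

theory Submission
  imports Defs
begin

section \<open>Characters and test functions on the torus\<close>

text \<open>
  The \<open>d\<close>-plane transform is diagonal in the Fourier basis. An integer basis of \<open>A\<close> spans a
  closed subtorus, and \<open>R\<^sub>d\<^sub>,\<^sub>A\<close> averages over its translates; a character
  \<open>exp (2 \<pi> i k \<bullet> x)\<close> is constant along the subtorus if \<open>k \<bottom> A\<close> and averages to \<open>0\<close>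
  otherwise. So the \<open>k\<close>-th coefficient of \<open>R\<^sub>d\<^sub>,\<^sub>A f\<close> is that of \<open>f\<close> for
  \<open>A \<in> \<Omega>\<^sub>k\<close> and \<open>0\<close> for other \<open>A\<close> (\<open>fcoeff_radon_distr\<close>), and the theorem becomes one about
  weighted sums over the incident pairs \<open>(k, A)\<close>. Summation over \<open>A\<close> first produces the factors
  \<open>W\<^sub>k\<close>, whose upper bound gives the continuity of \<open>R\<^sub>d\<close>. The adjoint formula is the interchange of
  an absolutely convergent double sum, and \<open>R\<^sub>d\<^sup>* g\<close> lies in \<open>H\<^sup>s\<close> by the Cauchy-Schwarz inequality
  for the weights \<open>w(k, A)\<^sup>2\<close>. Some \<open>d\<close>-plane is orthogonal to \<open>k\<close> because \<open>d \<le> n - 1\<close>, so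
  \<open>W\<^sub>k > 0\<close>. The coefficients of \<open>R\<^sub>d\<^sup>* R\<^sub>d f\<close> are \<open>W\<^sub>k\<close> times those of \<open>f\<close>; division by \<open>W\<^sub>k\<close>
  returns the coefficients of \<open>f\<close>, which are those of a distribution, and the inversion follows.

  Two facts carry statements about coefficients over to distributions: a distribution is determined
  by its Fourier coefficients (\<open>distribution_eqI\<close>), and every sequence of polynomial growth is a
  sequence of Fourier coefficients (\<open>distribution_with_coefficients\<close>). Both follow from the rapid
  decay of the Fourier coefficients of a test function and from the convergence of its Fourier
  series in every \<open>C\<^sup>N\<close> norm. This in turn needs integration by parts on the torus and the
  completeness of the characters, which comes from the Stone-Weierstrass theorem.

  The mean over the torus and the \<open>d\<close>-plane transform are both averages of translates by
  \<open>\<Sum>\<^sub>i t\<^sub>i v\<^sub>i\<close> over \<open>t\<close> in a unit cube, with lattice vectors \<open>v\<^sub>i\<close>. Such an average of a derivative in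
  a direction \<open>v\<^sub>i\<close> vanishes (\<open>cube_avg_directional_derivative\<close>); this one computation gives
  integration by parts and the value of the transform on characters.
\<close>

definition lattice_periodic :: "(real^'n::finite \<Rightarrow> complex) \<Rightarrow> bool" where
  "lattice_periodic f \<longleftrightarrow> (\<forall>x k. f (x + rvec k) = f x)"

definition torus_continuous :: "(real^'n::finite \<Rightarrow> complex) \<Rightarrow> bool" where
  "torus_continuous f \<longleftrightarrow> continuous_on UNIV f \<and> lattice_periodic f"

text \<open>
  The character of the torus with frequency \<open>k\<close>.
\<close>

definition chi :: "int^'n::finite \<Rightarrow> real^'n \<Rightarrow> complex" where
  "chi k x = exp (2 * complex_of_real pi * \<i> * complex_of_real (rvec k \<bullet> x))"

text \<open>
  The eigenvalue of an iterated partial derivative on a character.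
\<close>

definition deriv_symbol :: "'n list \<Rightarrow> int^'n::finite \<Rightarrow> complex" where
  "deriv_symbol js k = prod_list (map (\<lambda>i. 2 * complex_of_real pi * \<i> * of_int (k $ i)) js)"

lemma rvec_nth [simp]: "rvec k $ i = real_of_int (k $ i)"
  by (simp add: rvec_def)

lemma rvec_add: "rvec (k + l) = rvec k + rvec l"
  by (simp add: vec_eq_iff)

lemma rvec_minus: "rvec (- k) = - rvec k"
  by (simp add: vec_eq_iff)

lemma rvec_zero [simp]: "rvec 0 = 0"
  by (simp add: vec_eq_iff)

lemma inner_rvec: "rvec k \<bullet> rvec l = of_int (\<Sum>i\<in>UNIV. k $ i * l $ i)"
  by (simp add: inner_vec_def)

lemma partials_Nil [simp]: "partials [] f = f"
  and partials_Cons [simp]: "partials (i # js) f = partial i (partials js f)"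
  by (simp_all add: partials_def)

lemma partials_append: "partials (ks @ js) f = partials ks (partials js f)"
  by (simp add: partials_def)

lemma smooth_partials: "smooth f \<Longrightarrow> smooth (partials js f)"
  unfolding smooth_def by (metis partials_append)

lemma smooth_differentiable: "smooth f \<Longrightarrow> f differentiable (at x)"
  unfolding smooth_def by (metis partials_Nil)

lemma smooth_partial: "smooth f \<Longrightarrow> smooth (partial i f)"
  using smooth_partials[of f "[i]"] by simp

lemma smooth_continuous: "smooth f \<Longrightarrow> continuous_on UNIV f"
  by (simp add: continuous_at_imp_continuous_on differentiable_imp_continuous_within smooth_differentiable)

lemma partial_eqI: "(f has_derivative f') (at x) \<Longrightarrow> partial i f x = f' (axis i 1)"
  by (metis frechet_derivative_at partial_def)

lemma has_derivative_partials:
  fixes f :: "real^'n::finite \<Rightarrow> complex"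
  assumes "f differentiable (at x)"
  shows "(f has_derivative (\<lambda>h. \<Sum>i\<in>UNIV. h $ i *\<^sub>R partial i f x)) (at x)"
proof -
  have d: "(f has_derivative frechet_derivative f (at x)) (at x)"
    using assms frechet_derivative_works by blast
  then have lin: "linear (frechet_derivative f (at x))"
    by (rule has_derivative_linear)
  have "frechet_derivative f (at x) h = (\<Sum>i\<in>UNIV. h $ i *\<^sub>R partial i f x)" for h
  proof -
    have "h = (\<Sum>i\<in>UNIV. h $ i *\<^sub>R axis i 1)"
      using basis_expansion[of h] by (simp add: scalar_mult_eq_scaleR)
    then have "frechet_derivative f (at x) h = frechet_derivative f (at x) (\<Sum>i\<in>UNIV. h $ i *\<^sub>R axis i 1)"
      by simp
    also have "\<dots> = (\<Sum>i\<in>UNIV. h $ i *\<^sub>R partial i f x)"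
      by (simp add: linear_sum[OF lin] linear_cmul[OF lin] partial_def)
    finally show ?thesis .
  qed
  then show ?thesis using d by (metis (no_types, lifting) ext)
qed

lemma partial_add:
  assumes "f differentiable (at x)" "g differentiable (at x)"
  shows "partial i (\<lambda>x. f x + g x) x = partial i f x + partial i g x"
proof -
  have "((\<lambda>x. f x + g x) has_derivative (\<lambda>h. frechet_derivative f (at x) h + frechet_derivative g (at x) h)) (at x)"
    using assms frechet_derivative_works has_derivative_add by blast
  from partial_eqI[OF this] show ?thesis by (simp add: partial_def)
qed

lemma partial_cmult:
  assumes "f differentiable (at x)"
  shows "partial i (\<lambda>x. c * f x) x = c * partial i f x"
proof -
  have "((\<lambda>x. c * f x) has_derivative (\<lambda>h. c * frechet_derivative f (at x) h)) (at x)"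
    using assms frechet_derivative_works has_derivative_mult_right by blast
  from partial_eqI[OF this] show ?thesis by (simp add: partial_def)
qed

lemma partials_add:
  assumes "smooth f" "smooth g"
  shows "partials js (\<lambda>x. f x + g x) = (\<lambda>x. partials js f x + partials js g x)"
proof (induction js)
  case (Cons i js)
  show ?case
    unfolding partials_Cons Cons
    by (intro ext partial_add smooth_differentiable smooth_partials assms)
qed simp

lemma partials_cmult:
  assumes "smooth f"
  shows "partials js (\<lambda>x. c * f x) = (\<lambda>x. c * partials js f x)"
proof (induction js)
  case (Cons i js)
  show ?case
    unfolding partials_Cons Cons
    by (intro ext partial_cmult smooth_differentiable smooth_partials assms)
qed simp

lemma smooth_add: "smooth f \<Longrightarrow> smooth g \<Longrightarrow> smooth (\<lambda>x. f x + g x)"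
  using smooth_differentiable[OF smooth_partials]
  by (auto simp: smooth_def[of "\<lambda>x. f x + g x"] partials_add intro!: differentiable_add)

lemma smooth_cmult: "smooth f \<Longrightarrow> smooth (\<lambda>x. c * f x)"
  using smooth_differentiable[OF smooth_partials]
  by (auto simp: smooth_def[of "\<lambda>x. c * f x"] partials_cmult intro!: differentiable_mult)

lemma chi_has_derivative:
  "(chi k has_derivative (\<lambda>h. 2 * complex_of_real pi * \<i> * complex_of_real (rvec k \<bullet> h) * chi k x)) (at x)"
proof -
  have "((\<lambda>x. 2 * complex_of_real pi * \<i> * complex_of_real (rvec k \<bullet> x)) has_derivative
      (\<lambda>h. 2 * complex_of_real pi * \<i> * complex_of_real (rvec k \<bullet> h))) (at x)"
    by (intro has_derivative_mult_right has_derivative_of_real has_derivative_inner_right has_derivative_ident)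
  from has_derivative_compose[OF this DERIV_exp[THEN has_field_derivative_imp_has_derivative]]
  show ?thesis by (simp add: chi_def[abs_def] mult_ac)
qed

lemma chi_partials: "partials js (chi k) = (\<lambda>x. deriv_symbol js k * chi k x)"
proof (induction js)
  case Nil
  then show ?case by (simp add: deriv_symbol_def)
next
  case (Cons i js)
  have "partial i (\<lambda>x. deriv_symbol js k * chi k x) x = deriv_symbol (i # js) k * chi k x" for x
  proof -
    have "chi k differentiable (at x)"
      using chi_has_derivative differentiable_def by blast
    then show ?thesis
      by (simp add: partial_cmult partial_eqI[OF chi_has_derivative] deriv_symbol_def inner_axis)
  qed
  then show ?case unfolding partials_Cons Cons by auto
qed

lemma smooth_chi: "smooth (chi k)"
proof -
  have "chi k differentiable (at x)" for x
    using chi_has_derivative differentiable_def by blast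
  then show ?thesis by (simp add: smooth_def chi_partials)
qed

lemma chi_add_arg: "chi k (x + y) = chi k x * chi k y"
  by (simp add: chi_def inner_add_right distrib_left exp_add)

lemma chi_mult: "chi k x * chi l x = chi (k + l) x"
  by (simp add: chi_def rvec_add inner_add_left distrib_left exp_add)

lemma chi_zero [simp]: "chi 0 x = 1"
  by (simp add: chi_def)

lemma norm_chi [simp]: "cmod (chi k x) = 1"
  by (simp add: chi_def norm_exp)

lemma chi_rvec [simp]: "chi k (rvec l) = 1"
proof -
  define m where "m = (\<Sum>i\<in>UNIV. k $ i * l $ i)"
  have "chi k (rvec l) = exp ((2 * of_int m * complex_of_real pi) * \<i>)"
    unfolding chi_def inner_rvec m_def[symmetric] of_real_of_int_eq by (rule arg_cong[of _ _ exp]) simp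
  also have "\<dots> = 1"
    unfolding exp_eq_1 by (auto intro!: exI[of _ m])
  finally show ?thesis .
qed

lemma fcoeff_chi: "fcoeff u k = u (chi (- k))"
  unfolding fcoeff_def chi_def[abs_def] by (simp add: rvec_minus)

lemma test_functionsD:
  assumes "f \<in> test_functions"
  shows "smooth f" "lattice_periodic f"
  using assms by (auto simp: test_functions_def lattice_periodic_def)

lemma test_functionsI: "smooth f \<Longrightarrow> lattice_periodic f \<Longrightarrow> f \<in> test_functions"
  by (auto simp: test_functions_def lattice_periodic_def)

lemma chi_test: "chi k \<in> test_functions"
  by (intro test_functionsI smooth_chi) (simp add: lattice_periodic_def chi_add_arg)

lemma test_add: "f \<in> test_functions \<Longrightarrow> g \<in> test_functions \<Longrightarrow> (\<lambda>x. f x + g x) \<in> test_functions"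
  by (auto simp: test_functions_def smooth_add)

lemma test_cmult: "f \<in> test_functions \<Longrightarrow> (\<lambda>x. c * f x) \<in> test_functions"
  by (auto simp: test_functions_def smooth_cmult)

lemma test_sum:
  "finite F \<Longrightarrow> (\<And>k. k \<in> F \<Longrightarrow> f k \<in> test_functions) \<Longrightarrow> (\<lambda>x. \<Sum>k\<in>F. f k x) \<in> test_functions"
proof (induction F rule: finite_induct)
  case empty
  show ?case using test_cmult[OF chi_test, of 0 0] by simp
qed (simp add: test_add)

lemma partials_sum:
  "finite F \<Longrightarrow> (\<And>k. k \<in> F \<Longrightarrow> f k \<in> test_functions) \<Longrightarrow>
    partials js (\<lambda>x. \<Sum>k\<in>F. f k x) = (\<lambda>x. \<Sum>k\<in>F. partials js (f k) x)"
proof (induction F rule: finite_induct)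
  case empty
  show ?case using partials_cmult[OF smooth_chi, of js 0 0] by simp
next
  case (insert a F)
  then show ?case
    using partials_add[of "f a" "\<lambda>x. \<Sum>k\<in>F. f k x" js] test_functionsD test_sum[of F f] by auto
qed

text \<open>
  Uniqueness of the derivative: \<open>f\<close> and its translate by a lattice vector are the same function.
\<close>

lemma partial_periodic:
  assumes "smooth f" "lattice_periodic f"
  shows "lattice_periodic (partial i f)"
  unfolding lattice_periodic_def
proof (intro allI)
  fix x k
  have "f differentiable (at (x + rvec k))"
    using assms(1) smooth_differentiable by blast
  then have "(f has_derivative frechet_derivative f (at (x + rvec k))) (at (x + rvec k))"
    using frechet_derivative_works by blast
  then have "((\<lambda>y. f (y + rvec k)) has_derivative frechet_derivative f (at (x + rvec k))) (at x)"
    by (rule has_derivative_compose[rotated]) (auto intro!: derivative_eq_intros)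
  moreover have "(\<lambda>y. f (y + rvec k)) = f"
    using assms(2) by (auto simp: lattice_periodic_def)
  ultimately have "(f has_derivative frechet_derivative f (at (x + rvec k))) (at x)" by simp
  then show "partial i f (x + rvec k) = partial i f x"
    unfolding partial_def by (metis frechet_derivative_at)
qed

lemma partial_test: "f \<in> test_functions \<Longrightarrow> partial i f \<in> test_functions"
  by (meson partial_periodic smooth_partial test_functionsD test_functionsI)

lemma partials_test: "f \<in> test_functions \<Longrightarrow> partials js f \<in> test_functions"
  by (induction js) (auto simp: partial_test)

lemma periodic_reduce:
  fixes x :: "real^'n::finite"
  obtains y k where "y \<in> cbox 0 1" "x = y + rvec k"
proof
  define k :: "int^'n" where "k = (\<chi> i. \<lfloor>x $ i\<rfloor>)"
  show "x = (x - rvec k) + rvec k" by simp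
  have "0 \<le> x $ i - of_int \<lfloor>x $ i\<rfloor> \<and> x $ i - of_int \<lfloor>x $ i\<rfloor> \<le> 1" for i by linarith
  then show "x - rvec k \<in> cbox 0 1" by (simp add: mem_box_cart k_def)
qed

text \<open>
  The values are already attained on the compact unit cube.
\<close>

lemma torus_continuous_bounded:
  assumes "torus_continuous f"
  obtains B where "B \<ge> 0" "\<And>x. cmod (f x) \<le> B"
proof -
  have "compact (f ` cbox 0 1)"
    using assms compact_cbox unfolding torus_continuous_def
    by (meson compact_continuous_image continuous_on_subset subset_UNIV)
  then obtain B where B: "\<And>y. y \<in> cbox 0 1 \<Longrightarrow> cmod (f y) \<le> B"
    using compact_imp_bounded bounded_iff by (metis imageI)
  have le: "cmod (f x) \<le> B" for x
    by (rule periodic_reduce[of x]) (use assms B in \<open>auto simp: torus_continuous_def lattice_periodic_def\<close>)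
  moreover have "B \<ge> 0" using le[of 0] norm_ge_zero order_trans by blast
  ultimately show thesis using that by blast
qed

lemma test_continuous: "f \<in> test_functions \<Longrightarrow> continuous_on UNIV f"
  by (simp add: smooth_continuous test_functionsD)

lemma torus_continuous_test: "f \<in> test_functions \<Longrightarrow> torus_continuous f"
  by (simp add: torus_continuous_def test_continuous test_functionsD)

lemma torus_continuous_chi: "torus_continuous (chi k)"
  by (intro torus_continuous_test chi_test)

lemma torus_continuous_const: "torus_continuous (\<lambda>x. c)"
  by (simp add: torus_continuous_def lattice_periodic_def)

lemma torus_continuous_add: "torus_continuous f \<Longrightarrow> torus_continuous g \<Longrightarrow> torus_continuous (\<lambda>x. f x + g x)"
  and torus_continuous_diff: "torus_continuous f \<Longrightarrow> torus_continuous g \<Longrightarrow> torus_continuous (\<lambda>x. f x - g x)"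
  and torus_continuous_mult: "torus_continuous f \<Longrightarrow> torus_continuous g \<Longrightarrow> torus_continuous (\<lambda>x. f x * g x)"
  and torus_continuous_cnj: "torus_continuous f \<Longrightarrow> torus_continuous (\<lambda>x. cnj (f x))"
  by (auto simp: torus_continuous_def lattice_periodic_def intro!: continuous_intros)

lemma torus_continuous_sum: "(\<And>k. k \<in> F \<Longrightarrow> torus_continuous (f k)) \<Longrightarrow> torus_continuous (\<lambda>x. \<Sum>k\<in>F. f k x)"
  by (auto simp: torus_continuous_def lattice_periodic_def intro!: continuous_intros)

lemmas torus_continuous_intros = torus_continuous_chi torus_continuous_const
  torus_continuous_add torus_continuous_diff torus_continuous_mult torus_continuous_cnj torus_continuous_sum

lemma test_bounded:
  assumes "f \<in> test_functions" obtains B where "B \<ge> 0" "\<And>x. cmod (f x) \<le> B"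
  using torus_continuous_bounded torus_continuous_test[OF assms] by metis

text \<open>
  The partial derivatives are periodic and continuous, hence bounded.
\<close>

lemma test_Lipschitz:
  assumes f: "f \<in> test_functions"
  obtains L where "L \<ge> 0" "\<And>x y. cmod (f x - f y) \<le> L * norm (x - y)"
proof -
  have "\<forall>i. \<exists>B\<ge>0. \<forall>x. cmod (partial i f x) \<le> B"
    using test_bounded[OF partial_test[OF f]] by metis
  then obtain B where B: "\<And>i. B i \<ge> 0" "\<And>i x. cmod (partial i f x) \<le> B i" by metis
  define L where "L = sum B UNIV"
  have "cmod (f x - f y) \<le> L * norm (x - y)" for x y
  proof (rule differentiable_bound[OF convex_UNIV])
    fix x :: "real^'a"
    show "(f has_derivative (\<lambda>h. \<Sum>i\<in>UNIV. h $ i *\<^sub>R partial i f x)) (at x)"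
      by (intro has_derivative_partials smooth_differentiable test_functionsD f)
    show "onorm (\<lambda>h. \<Sum>i\<in>UNIV. h $ i *\<^sub>R partial i f x) \<le> L"
    proof (rule onorm_le)
      fix h :: "real^'a"
      have "cmod (\<Sum>i\<in>UNIV. h $ i *\<^sub>R partial i f x) \<le> (\<Sum>i\<in>UNIV. norm h * B i)"
        by (rule sum_norm_le) (auto intro!: mult_mono B component_le_norm_cart)
      then show "cmod (\<Sum>i\<in>UNIV. h $ i *\<^sub>R partial i f x) \<le> L * norm h"
        by (simp add: L_def sum_distrib_left mult.commute)
    qed
  qed auto
  moreover have "L \<ge> 0" unfolding L_def by (simp add: B(1) sum_nonneg)
  ultimately show thesis using that by blast
qed

text \<open>
  A first-order expansion with an error that is uniform in the base point, so that it survives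
  averaging over translates. The derivative of the remainder at \<open>z\<close> is the increment of the partial
  derivatives from \<open>x\<close> to \<open>z\<close>, which their Lipschitz bound controls.
\<close>

lemma test_Taylor:
  assumes f: "f \<in> test_functions"
  obtains K where "K \<ge> 0"
    "\<And>x h. cmod (f (x + h) - f x - (\<Sum>i\<in>UNIV. h $ i *\<^sub>R partial i f x)) \<le> K * (norm h)\<^sup>2"
proof -
  have "\<forall>i. \<exists>B\<ge>0. \<forall>x y. cmod (partial i f x - partial i f y) \<le> B * norm (x - y)"
    using test_Lipschitz[OF partial_test[OF f]] by metis
  then obtain B where B: "\<And>i. B i \<ge> 0"
    "\<And>i x y. cmod (partial i f x - partial i f y) \<le> B i * norm (x - y)" by metis
  define L where "L = sum B UNIV"
  have "cmod (f (x + h) - f x - (\<Sum>i\<in>UNIV. h $ i *\<^sub>R partial i f x)) \<le> L * (norm h)\<^sup>2" for x h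
  proof -
    let ?g = "\<lambda>z. f z - (\<Sum>i\<in>UNIV. (z - x) $ i *\<^sub>R partial i f x)"
    have "cmod (?g (x + h) - ?g x) \<le> (L * norm h) * norm (x + h - x)"
    proof (rule differentiable_bound[OF convex_cball[of x "norm h"]])
      fix z assume z: "z \<in> cball x (norm h)"
      have fd: "(f has_derivative (\<lambda>h. \<Sum>i\<in>UNIV. h $ i *\<^sub>R partial i f z)) (at z)"
        by (intro has_derivative_partials smooth_differentiable test_functionsD f)
      have "(?g has_derivative (\<lambda>h. (\<Sum>i\<in>UNIV. h $ i *\<^sub>R partial i f z)
              - (\<Sum>i\<in>UNIV. h $ i *\<^sub>R partial i f x))) (at z)"
        by (rule has_derivative_diff[OF fd])
          (auto intro!: derivative_eq_intros bounded_linear.has_derivative[OF bounded_linear_vec_nth])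
      then show "(?g has_derivative (\<lambda>h. (\<Sum>i\<in>UNIV. h $ i *\<^sub>R partial i f z)
              - (\<Sum>i\<in>UNIV. h $ i *\<^sub>R partial i f x))) (at z within cball x (norm h))"
        by (rule has_derivative_at_withinI)
      show "onorm (\<lambda>h. (\<Sum>i\<in>UNIV. h $ i *\<^sub>R partial i f z)
              - (\<Sum>i\<in>UNIV. h $ i *\<^sub>R partial i f x)) \<le> L * norm h"
      proof (rule onorm_le)
        fix k :: "real^'a"
        have "cmod ((\<Sum>i\<in>UNIV. k $ i *\<^sub>R partial i f z) - (\<Sum>i\<in>UNIV. k $ i *\<^sub>R partial i f x))
          = cmod (\<Sum>i\<in>UNIV. k $ i *\<^sub>R (partial i f z - partial i f x))"
          by (simp add: sum_subtractf scaleR_diff_right)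
        also have "\<dots> \<le> (\<Sum>i\<in>UNIV. norm k * (B i * norm h))"
        proof (rule sum_norm_le)
          fix i
          have "cmod (partial i f z - partial i f x) \<le> B i * norm h"
            using B(2)[of i z x] z B(1)[of i]
            by (smt (verit) dist_norm mem_cball mult_left_mono norm_minus_commute)
          then show "cmod (k $ i *\<^sub>R (partial i f z - partial i f x)) \<le> norm k * (B i * norm h)"
            by (simp, intro mult_mono) (auto simp: component_le_norm_cart)
        qed
        also have "\<dots> = L * norm h * norm k"
          by (simp add: L_def sum_distrib_left sum_distrib_right mult_ac)
        finally show "cmod ((\<Sum>i\<in>UNIV. k $ i *\<^sub>R partial i f z) - (\<Sum>i\<in>UNIV. k $ i *\<^sub>R partial i f x))
          \<le> L * norm h * norm k" .
      qed
    qed (auto simp: dist_norm)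
    then show ?thesis by (simp add: power2_eq_square mult.assoc diff_diff_eq add.commute)
  qed
  moreover have "L \<ge> 0" unfolding L_def by (simp add: B(1) sum_nonneg)
  ultimately show thesis using that by blast
qed

text \<open>
  The supremum in \<open>CN_norm\<close> is a supremum of reals, so it is meaningful only where it is finite;
  there are finitely many derivatives of order at most \<open>N\<close>, each of them bounded.
\<close>

lemma CN_bdd:
  assumes "f \<in> test_functions"
  shows "bdd_above ((\<lambda>(js, x). cmod (partials js f x)) ` ({js. length js \<le> N} \<times> UNIV))"
proof -
  have "\<forall>js. \<exists>B\<ge>0. \<forall>x. cmod (partials js f x) \<le> B"
    using test_bounded[OF partials_test[OF assms]] by metis
  then obtain B where B: "\<And>js. B js \<ge> 0" "\<And>js x. cmod (partials js f x) \<le> B js" by metis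
  have fin: "finite {js :: 'a list. length js \<le> N}"
    using finite_lists_length_le[of "UNIV :: 'a set" N] by simp
  show ?thesis
  proof (rule bdd_aboveI2, clarify)
    fix js :: "'a list" and x assume "length js \<le> N"
    then have "B js \<le> sum B {js. length js \<le> N}"
      by (intro member_le_sum fin) (auto simp: B)
    then show "cmod (partials js f x) \<le> sum B {js. length js \<le> N}"
      using B(2) order_trans by blast
  qed
qed

lemma CN_norm_upper:
  assumes "f \<in> test_functions" "length js \<le> N"
  shows "cmod (partials js f x) \<le> CN_norm N f"
  unfolding CN_norm_def
  using cSUP_upper[OF _ CN_bdd[OF assms(1)], of "(js, x)" N] assms(2) by simp

lemma CN_norm_least:
  assumes "\<And>js x. length js \<le> N \<Longrightarrow> cmod (partials js f x) \<le> B"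
  shows "CN_norm N f \<le> B"
  unfolding CN_norm_def by (rule cSUP_least) (use assms in \<open>auto intro: exI[of _ "[]"]\<close>)

lemma CN_norm_nonneg: "f \<in> test_functions \<Longrightarrow> 0 \<le> CN_norm N f"
  by (rule order_trans[OF norm_ge_zero CN_norm_upper[of f "[]" N 0]]) auto

lemma CN_norm_mono: "f \<in> test_functions \<Longrightarrow> N \<le> M \<Longrightarrow> CN_norm N f \<le> CN_norm M f"
  by (rule CN_norm_least) (auto intro: CN_norm_upper)

section \<open>Averages of translates\<close>

text \<open>
  An average when \<open>Q\<close> has total mass \<open>1\<close>, as in the two instances of interest: the torus mean
  and the plane transform, which thus share the facts of this section.
\<close>

definition shift_avg :: "'a measure \<Rightarrow> ('a \<Rightarrow> real^'n::finite) \<Rightarrow> (real^'n \<Rightarrow> complex) \<Rightarrow> real^'n \<Rightarrow> complex" where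
  "shift_avg Q \<tau> f = (\<lambda>x. LINT t|Q. f (x + \<tau> t))"

lemma shift_avg_measurable:
  fixes f :: "real^'n::finite \<Rightarrow> complex"
  assumes "continuous_on UNIV f" "\<tau> \<in> borel_measurable Q"
  shows "(\<lambda>t. f (x + \<tau> t)) \<in> borel_measurable Q"
proof -
  have "f \<in> borel_measurable borel"
    using assms(1) by (rule borel_measurable_continuous_onI)
  moreover have "(\<lambda>t. x + \<tau> t) \<in> borel_measurable Q"
    using assms(2) by (intro borel_measurable_add) auto
  ultimately show ?thesis by (rule measurable_compose[rotated])
qed

lemma (in finite_measure) shift_avg_integrable:
  fixes f :: "real^'n::finite \<Rightarrow> complex"
  assumes "continuous_on UNIV f" "\<tau> \<in> borel_measurable M" "\<And>x. cmod (f x) \<le> B"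
  shows "integrable M (\<lambda>t. f (x + \<tau> t))"
  by (rule integrable_const_bound[where B = B]) (use assms in \<open>auto intro: shift_avg_measurable\<close>)

lemma (in finite_measure) test_integrable:
  assumes "f \<in> test_functions" "\<tau> \<in> borel_measurable M"
  shows "integrable M (\<lambda>t. f (x + \<tau> t))"
  using test_bounded[OF assms(1)] shift_avg_integrable[OF test_continuous[OF assms(1)] assms(2)] by metis

lemma (in finite_measure) shift_avg_bound:
  assumes "\<And>x. cmod (f x) \<le> B" "B \<ge> 0"
  shows "cmod (shift_avg M \<tau> f x) \<le> B * measure M (space M)"
proof (cases "integrable M (\<lambda>t. f (x + \<tau> t))")
  case True
  have "cmod (shift_avg M \<tau> f x) \<le> (LINT t|M. cmod (f (x + \<tau> t)))"
    unfolding shift_avg_def by (rule integral_norm_bound)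
  also have "\<dots> \<le> (LINT t|M. B)"
    by (rule integral_mono) (use True assms in auto)
  finally show ?thesis by (simp add: mult.commute)
next
  case False
  then show ?thesis using assms(2) by (simp add: shift_avg_def not_integrable_integral_eq)
qed

text \<open>
  Differentiation under the integral sign: the expansion of \<open>f\<close> has an error bounded
  uniformly in the base point, so it can be integrated term by term.
\<close>

lemma (in finite_measure) shift_avg_has_derivative:
  assumes f: "f \<in> test_functions" and \<tau>: "\<tau> \<in> borel_measurable M"
  shows "(shift_avg M \<tau> f has_derivative (\<lambda>h. \<Sum>i\<in>UNIV. h $ i *\<^sub>R shift_avg M \<tau> (partial i f) x)) (at x)"
proof -
  obtain K where K: "K \<ge> 0"
    "\<And>x h. cmod (f (x + h) - f x - (\<Sum>i\<in>UNIV. h $ i *\<^sub>R partial i f x)) \<le> K * (norm h)\<^sup>2"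
    using test_Taylor[OF f] by metis
  define C where "C = K * measure M (space M)"
  have C: "C \<ge> 0" by (simp add: C_def K)
  let ?D = "\<lambda>h. \<Sum>i\<in>UNIV. h $ i *\<^sub>R shift_avg M \<tau> (partial i f) x"
  have le: "cmod (shift_avg M \<tau> f (x + h) - shift_avg M \<tau> f x - ?D h) \<le> C * (norm h)\<^sup>2" for h
  proof -
    have i1: "integrable M (\<lambda>t. f (y + \<tau> t))" for y by (rule test_integrable[OF f \<tau>])
    have i2: "integrable M (\<lambda>t. partial i f (x + \<tau> t))" for i
      by (rule test_integrable[OF partial_test[OF f] \<tau>])
    have "shift_avg M \<tau> f (x + h) - shift_avg M \<tau> f x - ?D h
      = (LINT t|M. f (x + h + \<tau> t) - f (x + \<tau> t) - (\<Sum>i\<in>UNIV. h $ i *\<^sub>R partial i f (x + \<tau> t)))"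
      unfolding shift_avg_def by (simp add: i1 i2)
    also have "\<dots> = shift_avg M \<tau> (\<lambda>y. f (y + h) - f y - (\<Sum>i\<in>UNIV. h $ i *\<^sub>R partial i f y)) x"
      by (simp add: shift_avg_def add_ac)
    also have "cmod \<dots> \<le> (K * (norm h)\<^sup>2) * measure M (space M)"
      by (rule shift_avg_bound) (use K in auto)
    finally show ?thesis by (simp add: C_def mult_ac)
  qed
  show ?thesis
    unfolding has_derivative_at_alt
  proof (intro conjI allI impI)
    show "bounded_linear ?D"
      by (intro bounded_linear_sum bounded_linear_scaleR_const bounded_linear_vec_nth)
    fix e :: real assume e: "e > 0"
    show "\<exists>d>0. \<forall>y. norm (y - x) < d \<longrightarrow>
        cmod (shift_avg M \<tau> f y - shift_avg M \<tau> f x - ?D (y - x)) \<le> e * norm (y - x)"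
    \<comment> \<open>\<open>C + 1\<close> instead of \<open>C\<close>, which may be \<open>0\<close>.\<close>
    proof (intro exI[of _ "e / (C + 1)"] conjI allI impI)
      show "e / (C + 1) > 0" using e C by simp
      fix y assume y: "norm (y - x) < e / (C + 1)"
      have "C * norm (y - x) \<le> (C + 1) * (e / (C + 1))"
        by (rule mult_mono) (use y C e in auto)
      then have "C * norm (y - x) * norm (y - x) \<le> e * norm (y - x)"
        using C by (intro mult_right_mono) auto
      then show "cmod (shift_avg M \<tau> f y - shift_avg M \<tau> f x - ?D (y - x)) \<le> e * norm (y - x)"
        using le[of "y - x"] by (simp add: power2_eq_square mult.assoc)
    qed
  qed
qed

lemma (in finite_measure) shift_avg_partials:
  assumes f: "f \<in> test_functions" and \<tau>: "\<tau> \<in> borel_measurable M"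
  shows "partials js (shift_avg M \<tau> f) = shift_avg M \<tau> (partials js f)"
proof (induction js)
  case (Cons i js)
  have "partial i (shift_avg M \<tau> (partials js f)) x = shift_avg M \<tau> (partial i (partials js f)) x" for x
  proof -
    have "axis i 1 $ j *\<^sub>R z = (if j = i then z else 0)" for j and z :: complex
      by (simp add: axis_def)
    then show ?thesis
      unfolding partial_eqI[OF shift_avg_has_derivative[OF partials_test[OF f] \<tau>]] by simp
  qed
  then show ?case using Cons by auto
qed simp

lemma (in finite_measure) shift_avg_test:
  assumes f: "f \<in> test_functions" and \<tau>: "\<tau> \<in> borel_measurable M"
  shows "shift_avg M \<tau> f \<in> test_functions"
proof (rule test_functionsI)
  show "smooth (shift_avg M \<tau> f)"
    unfolding smooth_def shift_avg_partials[OF assms]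
    using shift_avg_has_derivative[OF partials_test[OF f] \<tau>] differentiable_def by blast
  have "f (x + rvec k + y) = f (x + y)" for x y k
    using test_functionsD(2)[OF f] by (metis add.assoc add.commute lattice_periodic_def)
  then show "lattice_periodic (shift_avg M \<tau> f)"
    by (simp add: lattice_periodic_def shift_avg_def)
qed

lemma (in finite_measure) shift_avg_CN_norm:
  assumes f: "f \<in> test_functions" and \<tau>: "\<tau> \<in> borel_measurable M"
  shows "CN_norm N (shift_avg M \<tau> f) \<le> CN_norm N f * measure M (space M)"
proof (rule CN_norm_least)
  fix js :: "'b list" and x assume "length js \<le> N"
  then show "cmod (partials js (shift_avg M \<tau> f) x) \<le> CN_norm N f * measure M (space M)"
    unfolding shift_avg_partials[OF assms]
    by (intro shift_avg_bound CN_norm_upper CN_norm_nonneg f)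
qed

lemma (in finite_measure) shift_avg_add:
  assumes "f \<in> test_functions" "g \<in> test_functions" "\<tau> \<in> borel_measurable M"
  shows "shift_avg M \<tau> (\<lambda>x. f x + g x) = (\<lambda>x. shift_avg M \<tau> f x + shift_avg M \<tau> g x)"
  by (simp add: shift_avg_def test_integrable assms)

lemma shift_avg_cmult: "shift_avg Q \<tau> (\<lambda>x. c * f x) = (\<lambda>x. c * shift_avg Q \<tau> f x)"
  by (simp add: shift_avg_def)

definition cube_measure :: "'i set \<Rightarrow> ('i \<Rightarrow> real) measure" where
  "cube_measure I = restrict_space (\<Pi>\<^sub>M i\<in>I. lborel) (I \<rightarrow>\<^sub>E {0..1})"

definition lattice_shift :: "'i set \<Rightarrow> ('i \<Rightarrow> real^'n::finite) \<Rightarrow> ('i \<Rightarrow> real) \<Rightarrow> real^'n" where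
  "lattice_shift I v t = (\<Sum>i\<in>I. t i *\<^sub>R v i)"

lemma lattice_shift_measurable_PiM [measurable]:
  "lattice_shift I v \<in> borel_measurable (\<Pi>\<^sub>M i\<in>I. lborel)"
  unfolding lattice_shift_def[abs_def] by measurable

lemma lattice_shift_measurable: "lattice_shift I v \<in> borel_measurable (cube_measure I)"
  unfolding cube_measure_def by (rule measurable_restrict_space1) measurable

lemma cube_sets:
  assumes "finite I"
  shows "(I \<rightarrow>\<^sub>E {0..1}) \<inter> space (\<Pi>\<^sub>M i\<in>I. (lborel :: real measure)) \<in> sets (\<Pi>\<^sub>M i\<in>I. lborel)"
  using sets_PiM_I_finite[OF assms, of "\<lambda>_. {0..1::real}" "\<lambda>_. lborel"] by auto

lemma emeasure_cube:
  assumes "finite I"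
  shows "emeasure (cube_measure I) (space (cube_measure I)) = 1"
proof -
  interpret product_sigma_finite "\<lambda>_. lborel :: real measure" ..
  have "space (cube_measure I) = (I \<rightarrow>\<^sub>E {0..1})"
    by (auto simp: cube_measure_def space_restrict_space space_PiM PiE_def)
  then show ?thesis
    using emeasure_PiM[OF assms, of "\<lambda>_. {0..1}"]
    by (simp add: cube_measure_def emeasure_restrict_space cube_sets assms)
qed

lemma finite_measure_cube: "finite I \<Longrightarrow> finite_measure (cube_measure I)"
  by (rule finite_measureI) (simp add: emeasure_cube)

lemma measure_cube: "finite I \<Longrightarrow> measure (cube_measure I) (space (cube_measure I)) = 1"
  by (simp add: measure_def emeasure_cube)

text \<open>
  By Fubini the coordinate \<open>t j\<close> is integrated first. Along it the integrand is the derivative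
  of \<open>f\<close> on a segment from a point to its translate by the lattice vector \<open>v j\<close>, where \<open>f\<close> takes
  the same value.
\<close>

lemma cube_avg_directional_derivative:
  fixes v :: "'i \<Rightarrow> real^'n::finite"
  assumes I: "finite I" "j \<in> I" and v: "v j = rvec k"
    and f: "lattice_periodic f" "\<And>x. (f has_derivative f' x) (at x)"
    and g: "\<And>x. g x = f' x (v j)" "continuous_on UNIV g" "\<And>x. cmod (g x) \<le> B"
  shows "shift_avg (cube_measure I) (lattice_shift I v) g x = 0"
proof -
  interpret product_sigma_finite "\<lambda>_. lborel :: real measure" ..
  interpret Q: finite_measure "cube_measure I" by (rule finite_measure_cube[OF I(1)])
  define J where "J = I - {j}"
  have J: "finite J" "j \<notin> J" "I = insert j J" using I by (auto simp: J_def)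
  let ?F = "\<lambda>t. indicator (I \<rightarrow>\<^sub>E {0..1}) t *\<^sub>R g (x + lattice_shift I v t)"
  have int: "integrable (\<Pi>\<^sub>M i\<in>insert j J. lborel) ?F"
    using Q.shift_avg_integrable[OF g(2) lattice_shift_measurable[of I v] g(3), where x = x]
    by (simp add: cube_measure_def integrable_restrict_space cube_sets I J(3)[symmetric])
  have inner: "(\<integral>y. ?F (t(j := y)) \<partial>lborel) = 0" if t: "t \<in> space (\<Pi>\<^sub>M i\<in>J. lborel)" for t
  proof -
    define z where "z = x + lattice_shift J v t"
    have *: "?F (t(j := y)) = indicator (J \<rightarrow>\<^sub>E {0..1}) t *\<^sub>R (indicator {0..1} y *\<^sub>R g (z + y *\<^sub>R v j))" for y
    proof -
      have "t(j := y) \<in> (I \<rightarrow>\<^sub>E {0..1}) \<longleftrightarrow> t \<in> (J \<rightarrow>\<^sub>E {0..1}) \<and> y \<in> {0..1}"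
        using t J(2) by (auto simp: J(3) space_PiM PiE_iff extensional_def)
      moreover have "lattice_shift I v (t(j := y)) = lattice_shift J v t + y *\<^sub>R v j"
        using J(1,2) by (auto simp: lattice_shift_def J(3) add.commute intro!: sum.cong)
      ultimately show ?thesis by (auto simp: indicator_def z_def add_ac)
    qed
    have der: "((\<lambda>y. f (z + y *\<^sub>R v j)) has_vector_derivative g (z + y *\<^sub>R v j)) (at y within S)" for y S
    proof -
      have lin: "linear (f' (z + y *\<^sub>R v j))" using f(2) has_derivative_linear by blast
      have "((\<lambda>y. z + y *\<^sub>R v j) has_derivative (\<lambda>h. h *\<^sub>R v j)) (at y within S)"
        by (auto intro!: derivative_eq_intros)
      from has_derivative_compose[OF this f(2)] show ?thesis
        by (simp add: has_vector_derivative_def g(1) linear_cmul[OF lin])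
    qed
    have "(\<integral>y. indicator {0..1} y *\<^sub>R g (z + y *\<^sub>R v j) \<partial>lborel) = f (z + 1 *\<^sub>R v j) - f (z + 0 *\<^sub>R v j)"
      by (rule integral_FTC_Icc) (auto intro!: der continuous_on_compose2[OF g(2)] continuous_intros)
    also have "\<dots> = 0"
      using f(1) by (simp add: v lattice_periodic_def)
    finally show ?thesis unfolding * by (simp only: integral_scaleR_right scaleR_zero_right)
  qed
  have "shift_avg (cube_measure I) (lattice_shift I v) g x = integral\<^sup>L (\<Pi>\<^sub>M i\<in>insert j J. lborel) ?F"
    by (simp add: shift_avg_def cube_measure_def integral_restrict_space cube_sets I J(3)[symmetric])
  also have "\<dots> = (\<integral>t. (\<integral>y. ?F (t(j := y)) \<partial>lborel) \<partial>(\<Pi>\<^sub>M i\<in>J. lborel))"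
    by (rule product_integral_insert[OF J(1,2) int])
  also have "\<dots> = (\<integral>t. 0 \<partial>(\<Pi>\<^sub>M i\<in>J. (lborel :: real measure)))"
    by (rule Bochner_Integration.integral_cong) (use inner in auto)
  finally show ?thesis by simp
qed

text \<open>
  If \<open>k\<close> is orthogonal to all \<open>v i\<close>, then the character is invariant under the shifts. Otherwise it
  is, up to a nonzero factor, its own derivative in a direction \<open>v j\<close>, and such derivatives average
  to \<open>0\<close>.
\<close>

lemma cube_avg_chi:
  fixes v :: "'i \<Rightarrow> real^'n::finite"
  assumes I: "finite I" and v: "\<And>i. i \<in> I \<Longrightarrow> v i \<in> range rvec"
  shows "shift_avg (cube_measure I) (lattice_shift I v) (chi k)
    = (\<lambda>x. if \<forall>i\<in>I. rvec k \<bullet> v i = 0 then chi k x else 0)"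
proof
  fix x
  show "shift_avg (cube_measure I) (lattice_shift I v) (chi k) x
    = (if \<forall>i\<in>I. rvec k \<bullet> v i = 0 then chi k x else 0)"
  proof (cases "\<forall>i\<in>I. rvec k \<bullet> v i = 0")
    case True
    then have "chi k (x + lattice_shift I v t) = chi k x" for t
      by (simp add: chi_def lattice_shift_def inner_add_right inner_sum_right)
    then show ?thesis using True by (simp add: shift_avg_def measure_cube[OF I])
  next
    case False
    then obtain j l where j: "j \<in> I" "rvec k \<bullet> v j \<noteq> 0" "v j = rvec l" using v by blast
    define c where "c = 2 * complex_of_real pi * \<i> * complex_of_real (rvec k \<bullet> v j)"
    have "shift_avg (cube_measure I) (lattice_shift I v) (\<lambda>x. c * chi k x) x = 0"
    proof (rule cube_avg_directional_derivative[where f = "chi k" and v = v and j = j and k = l and B = "cmod c"])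
      show "lattice_periodic (chi k)" by (rule test_functionsD[OF chi_test])
      show "continuous_on UNIV (\<lambda>x. c * chi k x)"
        by (intro continuous_intros test_continuous chi_test)
      show "cmod (c * chi k x) \<le> cmod c" for x by (simp add: norm_mult)
      show "c * chi k x = 2 * complex_of_real pi * \<i> * complex_of_real (rvec k \<bullet> v j) * chi k x" for x
        by (simp add: c_def)
    qed (fact I j chi_has_derivative)+
    then have "shift_avg (cube_measure I) (lattice_shift I v) (chi k) x = 0"
      using j(2) by (simp add: shift_avg_cmult c_def)
    then show ?thesis using False by auto
  qed
qed

section \<open>The mean over the torus\<close>

definition torus_mean :: "(real^'n::finite \<Rightarrow> complex) \<Rightarrow> complex" where
  "torus_mean f = shift_avg (cube_measure Basis) (lattice_shift Basis (\<lambda>b :: real^'n. b)) f 0"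

lemma Basis_rvec: "b \<in> Basis \<Longrightarrow> b \<in> range (rvec :: int^'n::finite \<Rightarrow> _)"
proof -
  assume "b \<in> Basis"
  then obtain i where "b = axis i 1" by (auto simp: Basis_vec_def)
  then have "b = rvec (axis i 1)" by (simp add: vec_eq_iff axis_def)
  then show ?thesis by simp
qed

lemma torus_mean_chi: "torus_mean (chi k) = (if k = 0 then 1 else 0)"
proof -
  have "(\<forall>b\<in>Basis. rvec k \<bullet> b = 0) \<longleftrightarrow> k = 0"
    unfolding euclidean_all_zero_iff by (simp add: vec_eq_iff)
  then show ?thesis
    unfolding torus_mean_def by (subst cube_avg_chi) (auto intro: Basis_rvec)
qed

lemma torus_mean_integrable:
  assumes "torus_continuous f"
  shows "integrable (cube_measure Basis) (\<lambda>t. f (0 + lattice_shift Basis (\<lambda>b. b) t))"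
proof -
  obtain B where "\<And>x. cmod (f x) \<le> B" using torus_continuous_bounded[OF assms] by metis
  then show ?thesis
    using assms by (intro finite_measure.shift_avg_integrable finite_measure_cube lattice_shift_measurable)
      (auto simp: torus_continuous_def)
qed

lemma torus_mean_add:
  "torus_continuous f \<Longrightarrow> torus_continuous g \<Longrightarrow> torus_mean (\<lambda>x. f x + g x) = torus_mean f + torus_mean g"
  using torus_mean_integrable[of f] torus_mean_integrable[of g]
  by (simp add: torus_mean_def shift_avg_def)

lemma torus_mean_cmult: "torus_mean (\<lambda>x. c * f x) = c * torus_mean f"
  by (simp add: torus_mean_def shift_avg_cmult)

lemma torus_mean_bound:
  assumes "\<And>x. cmod (f x) \<le> B"
  shows "cmod (torus_mean f) \<le> B"
proof -
  have "B \<ge> 0" using assms[of 0] norm_ge_zero order_trans by blast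
  then show ?thesis
    using finite_measure.shift_avg_bound[OF finite_measure_cube[OF finite_Basis] assms, where x = 0 and \<tau> = "lattice_shift Basis (\<lambda>b. b)"]
    by (simp add: torus_mean_def measure_cube)
qed

text \<open>
  Lebesgue measure is the image of the product measure under the coordinate map. The form as an
  integral over the cube gives access to the strict positivity of integrals of continuous functions.
\<close>

lemma torus_mean_eq_integral:
  fixes f :: "real^'n::finite \<Rightarrow> complex"
  assumes f: "torus_continuous f"
  shows "torus_mean f = integral (cbox 0 One) f"
proof -
  have cont: "continuous_on UNIV f" using f by (simp add: torus_continuous_def)
  let ?s = "lattice_shift Basis (\<lambda>b :: real^'n. b)"
  have "torus_mean f = (\<integral>t. indicator (Basis \<rightarrow>\<^sub>E {0..1}) t *\<^sub>R f (?s t) \<partial>(\<Pi>\<^sub>M b\<in>Basis. lborel))"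
    by (simp add: torus_mean_def shift_avg_def cube_measure_def integral_restrict_space cube_sets)
  also have "\<dots> = (\<integral>t. indicator (cbox 0 One) (?s t) *\<^sub>R f (?s t) \<partial>(\<Pi>\<^sub>M b\<in>Basis. lborel))"
  proof (rule Bochner_Integration.integral_cong[OF refl])
    fix t :: "real^'n \<Rightarrow> real" assume "t \<in> space (\<Pi>\<^sub>M b\<in>Basis. (lborel :: real measure))"
    then have "t \<in> (Basis \<rightarrow>\<^sub>E {0..1}) \<longleftrightarrow> ?s t \<in> cbox 0 One"
      by (auto simp: space_PiM PiE_iff mem_box lattice_shift_def)
    then show "indicator (Basis \<rightarrow>\<^sub>E {0..1}) t *\<^sub>R f (?s t) = indicator (cbox 0 One) (?s t) *\<^sub>R f (?s t)"
      by (simp add: indicator_def)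
  qed
  also have "\<dots> = (\<integral>x. indicator (cbox 0 One) x *\<^sub>R f x \<partial>lborel)"
  proof -
    let ?g = "\<lambda>x. indicator (cbox 0 One) x *\<^sub>R f x"
    have "integral\<^sup>L lborel ?g = integral\<^sup>L (distr (\<Pi>\<^sub>M b\<in>Basis. lborel) borel ?s) ?g"
      unfolding lattice_shift_def by (simp only: lborel_eq[symmetric])
    also have "\<dots> = (\<integral>t. ?g (?s t) \<partial>(\<Pi>\<^sub>M b\<in>Basis. lborel))"
      using borel_measurable_continuous_onI[OF cont] by (intro integral_distr) auto
    finally show ?thesis by simp
  qed
  also have "\<dots> = integral (cbox 0 One) f"
    using set_borel_integral_eq_integral(2)[of "cbox 0 One" f]
      borel_integrable_compact[OF compact_cbox continuous_on_subset[OF cont subset_UNIV], of 0 One]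
    by (simp add: set_lebesgue_integral_def set_integrable_def)
  finally show ?thesis .
qed

lemma torus_mean_faithful:
  fixes h :: "real^'n::finite \<Rightarrow> complex"
  assumes h: "torus_continuous h"
    and zero: "torus_mean (\<lambda>x. h x * cnj (h x)) = 0"
  shows "h x = 0"
proof -
  let ?g = "\<lambda>x. (cmod (h x))\<^sup>2"
  have cont: "continuous_on UNIV ?g"
    using h by (auto simp: torus_continuous_def intro!: continuous_intros)
  have One: "(One :: real^'n) = 1"
  proof -
    have "(One :: real^'n) \<bullet> axis i 1 = 1" for i by simp
    then show ?thesis by (simp add: vec_eq_iff inner_axis)
  qed
  have G: "torus_continuous (\<lambda>x. h x * cnj (h x))" by (intro torus_continuous_intros h)
  then have G': "continuous_on UNIV (\<lambda>x. h x * cnj (h x))" by (simp add: torus_continuous_def)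
  have "((\<lambda>x. h x * cnj (h x)) has_integral 0) (cbox 0 One)"
    using zero integrable_continuous[OF continuous_on_subset[OF G' subset_UNIV]]
    unfolding torus_mean_eq_integral[OF G] by (metis has_integral_integrable_integral)
  from has_integral_linear[OF this bounded_linear_Re] have "(?g has_integral 0) (cbox 0 One)"
    by (simp add: o_def complex_norm_square[symmetric] flip: of_real_power)
  then have *: "h y = 0" if "y \<in> cbox 0 One" for y
    using has_integral_0_cbox_imp_0[of 0 One ?g y] that continuous_on_subset[OF cont subset_UNIV]
    by (simp add: box_ne_empty)
  obtain y k where "y \<in> cbox 0 1" "x = y + rvec k" by (rule periodic_reduce)
  then show ?thesis using * h by (simp add: One torus_continuous_def lattice_periodic_def)
qed

section \<open>Trigonometric polynomials are uniformly dense\<close>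

inductive_set trig_poly :: "(real^'n::finite \<Rightarrow> complex) set" where
  monomial: "(\<lambda>x. c * chi k x) \<in> trig_poly"
| add: "f \<in> trig_poly \<Longrightarrow> g \<in> trig_poly \<Longrightarrow> (\<lambda>x. f x + g x) \<in> trig_poly"

lemma trig_test: "f \<in> trig_poly \<Longrightarrow> f \<in> test_functions"
  by (induction rule: trig_poly.induct) (auto intro: test_cmult chi_test test_add)

lemma trig_const: "(\<lambda>x. c) \<in> trig_poly"
  using trig_poly.monomial[of c 0] by simp

lemma trig_mult_monomial: "f \<in> trig_poly \<Longrightarrow> (\<lambda>x. (c * chi k x) * f x) \<in> trig_poly"
proof (induction rule: trig_poly.induct)
  case (monomial d l)
  have "(\<lambda>x. (c * chi k x) * (d * chi l x)) = (\<lambda>x. (c * d) * chi (k + l) x)"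
    by (simp add: chi_mult[symmetric] mult_ac)
  then show ?case using trig_poly.monomial by metis
next
  case (add f g)
  then show ?case using trig_poly.add by (simp add: distrib_left)
qed

lemma trig_mult: "g \<in> trig_poly \<Longrightarrow> f \<in> trig_poly \<Longrightarrow> (\<lambda>x. g x * f x) \<in> trig_poly"
proof (induction rule: trig_poly.induct)
  case (monomial d l)
  then show ?case by (rule trig_mult_monomial)
next
  case (add f g)
  then show ?case by (auto simp: distrib_right intro: trig_poly.add)
qed

lemma trig_sum: "finite F \<Longrightarrow> (\<And>k. k \<in> F \<Longrightarrow> f k \<in> trig_poly) \<Longrightarrow> (\<lambda>x. \<Sum>k\<in>F. f k x) \<in> trig_poly"
  by (induction F rule: finite_induct) (auto intro: trig_const trig_poly.add)

text \<open>
  An embedding of the torus as a compact subset of a Euclidean space, on which polynomials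
  restrict to trigonometric polynomials.
\<close>

definition torus_embedding :: "real^'n::finite \<Rightarrow> complex^'n" where
  "torus_embedding x = (\<chi> i. cis (2 * pi * x $ i))"

lemma torus_embedding_eqD:
  assumes "torus_embedding x = torus_embedding y"
  obtains k where "x = y + rvec k"
proof -
  have "\<exists>n::int. x $ i = y $ i + of_int n" for i
  proof -
    have "exp (\<i> * complex_of_real (2 * pi * x $ i)) = exp (\<i> * complex_of_real (2 * pi * y $ i))"
      using assms by (simp add: torus_embedding_def vec_eq_iff cis_conv_exp)
    then obtain n :: int where "\<i> * complex_of_real (2 * pi * x $ i)
        = \<i> * complex_of_real (2 * pi * y $ i) + (of_int (2 * n) * pi) * \<i>"
      unfolding exp_eq by blast
    then have "Im (\<i> * complex_of_real (2 * pi * x $ i))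
        = Im (\<i> * complex_of_real (2 * pi * y $ i) + (of_int (2 * n) * pi) * \<i>)" by simp
    then have "2 * pi * x $ i = 2 * pi * (y $ i + of_int n)"
      by (simp add: algebra_simps)
    then have "x $ i = y $ i + of_int n" by simp
    then show ?thesis by blast
  qed
  then obtain n where "\<And>i. x $ i = y $ i + of_int (n i)" by metis
  then have "x = y + rvec (\<chi> i. n i)" by (simp add: vec_eq_iff)
  then show thesis using that by blast
qed

lemma continuous_torus_embedding: "continuous_on S torus_embedding"
  unfolding torus_embedding_def[abs_def] by (intro continuous_intros)

lemma chi_axis: "chi (axis i m) x = cis (2 * pi * of_int m * x $ i)"
proof -
  have "rvec (axis i m) = axis i (of_int m)" by (simp add: vec_eq_iff axis_def)
  then show ?thesis by (simp add: chi_def cis_conv_exp inner_axis' mult_ac)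
qed

text \<open>
  Coordinates of the embedding are \<open>cos (2 \<pi> x\<^sub>i)\<close> and \<open>sin (2 \<pi> x\<^sub>i)\<close>, combinations of the characters
  with frequencies \<open>e\<^sub>i\<close> and \<open>- e\<^sub>i\<close>.
\<close>

lemma trig_linear_embedding:
  assumes "bounded_linear L"
  shows "(\<lambda>x. complex_of_real (L (torus_embedding x))) \<in> trig_poly"
proof -
  have lin: "linear L" using assms by (rule bounded_linear.linear)
  let ?a = "\<lambda>i. L (axis i 1)" and ?b = "\<lambda>i. L (axis i \<i>)"
  have dec: "torus_embedding x
      = (\<Sum>i\<in>UNIV. cos (2 * pi * x $ i) *\<^sub>R axis i 1 + sin (2 * pi * x $ i) *\<^sub>R axis i \<i>)" for x :: "real^'a"
  proof -
    have "(\<Sum>i\<in>UNIV. cos (2 * pi * x $ i) *\<^sub>R axis i 1 + sin (2 * pi * x $ i) *\<^sub>R axis i \<i>) $ j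
      = (\<Sum>i\<in>UNIV. if i = j then cis (2 * pi * x $ j) else 0)" for j
      unfolding sum_component by (intro sum.cong refl) (auto simp: axis_def complex_eq_iff)
    then show ?thesis by (simp add: torus_embedding_def vec_eq_iff)
  qed
  have cs: "complex_of_real (cos t) = (cis t + cis (- t)) / 2"
    "complex_of_real (sin t) = (cis t - cis (- t)) / (2 * \<i>)" for t
    by (simp_all add: complex_eq_iff)
  have "(\<lambda>x. complex_of_real (L (torus_embedding x))) =
    (\<lambda>x. \<Sum>i\<in>UNIV. ((of_real (?a i) / 2 + of_real (?b i) / (2 * \<i>)) * chi (axis i 1) x
                + (of_real (?a i) / 2 - of_real (?b i) / (2 * \<i>)) * chi (axis i (-1)) x))"
    unfolding dec
    by (simp add: linear_sum[OF lin] linear_add[OF lin] linear_cmul[OF lin] cs chi_axis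
        add_divide_distrib diff_divide_distrib algebra_simps)
  also have "\<dots> \<in> trig_poly"
    by (intro trig_sum trig_poly.intros) auto
  finally show ?thesis .
qed

lemma trig_polynomial_embedding:
  "real_polynomial_function p \<Longrightarrow> (\<lambda>x. complex_of_real (p (torus_embedding x))) \<in> trig_poly"
  by (induction rule: real_polynomial_function.induct)
    (auto intro: trig_linear_embedding trig_const trig_poly.add trig_mult)

text \<open>
  A continuous periodic function descends to a continuous function \<open>H\<close> on the embedded torus, since
  the embedding maps the compact cube onto it and is therefore a quotient map. Stone-Weierstrass
  approximates \<open>H\<close> by a polynomial, whose pullback is a trigonometric polynomial.
\<close>

lemma trig_dense_uniform:
  assumes h: "torus_continuous h" and e: "e > 0"
  obtains p where "p \<in> trig_poly" "\<And>x. cmod (h x - p x) < e"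
proof -
  define H where "H z = h (SOME x. torus_embedding x = z)" for z
  have H: "H (torus_embedding x) = h x" for x
  proof -
    have "torus_embedding (SOME y. torus_embedding y = torus_embedding x) = torus_embedding x"
      by (rule someI_ex) auto
    then show ?thesis
      unfolding H_def using h by (metis lattice_periodic_def torus_continuous_def torus_embedding_eqD)
  qed
  let ?T = "torus_embedding ` cbox 0 (1 :: real^'a)"
  have "compact ?T"
    by (intro compact_continuous_image continuous_torus_embedding compact_cbox)
  moreover have "continuous_on ?T H"
  proof (subst continuous_on_closed_vimage, intro compact_imp_closed \<open>compact ?T\<close>, intro allI impI)
    fix C :: "complex set" assume "closed C"
    then have "closed (h -` C)" using h by (simp add: torus_continuous_def closed_vimage)
    then have "compact (cbox 0 1 \<inter> h -` C)" by (intro compact_Int_closed compact_cbox)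
    then have "compact (torus_embedding ` (cbox 0 1 \<inter> h -` C))"
      by (intro compact_continuous_image continuous_torus_embedding)
    moreover have "H -` C \<inter> ?T = torus_embedding ` (cbox 0 1 \<inter> h -` C)"
      using H by auto
    ultimately show "closed (H -` C \<inter> ?T)" by (simp add: compact_imp_closed)
  qed
  ultimately obtain g where g: "polynomial_function g" "\<And>z. z \<in> ?T \<Longrightarrow> cmod (H z - g z) < e"
    using Stone_Weierstrass_polynomial_function[OF _ _ e] by metis
  define p where "p x = complex_of_real (Re (g (torus_embedding x))) + \<i> * complex_of_real (Im (g (torus_embedding x)))" for x
  have "real_polynomial_function (Re \<circ> g)" "real_polynomial_function (Im \<circ> g)"
    using g(1) bounded_linear_Re bounded_linear_Im by (auto simp: polynomial_function_def)
  then have p: "p \<in> trig_poly"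
    unfolding p_def[abs_def]
    using trig_polynomial_embedding[of "Re \<circ> g"] trig_polynomial_embedding[of "Im \<circ> g"]
    by (auto intro!: trig_poly.add trig_mult trig_const)
  have "cmod (h x - p x) < e" for x
  proof -
    obtain y k where y: "y \<in> cbox 0 1" "x = y + rvec k" by (rule periodic_reduce)
    have "h x = h y" "p x = p y"
      using h test_functionsD(2)[OF trig_test[OF p]]
      by (auto simp: y(2) torus_continuous_def lattice_periodic_def)
    then show ?thesis
      using g(2)[of "torus_embedding y"] y(1) by (simp add: H p_def complex_eq[symmetric])
  qed
  then show thesis using that p by blast
qed

section \<open>Fourier coefficients and Fourier series of test functions\<close>

text \<open>
  Fourier coefficients of functions; \<open>fcoeff\<close> is the corresponding notion for distributions.
\<close>

definition fhat :: "(real^'n::finite \<Rightarrow> complex) \<Rightarrow> int^'n \<Rightarrow> complex" where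
  "fhat f k = torus_mean (\<lambda>x. f x * chi (- k) x)"

text \<open>
  Such an \<open>h\<close> is orthogonal to all trigonometric polynomials, and these approximate \<open>cnj h\<close>
  uniformly; so the mean of \<open>h * cnj h\<close> is \<open>0\<close>.
\<close>

lemma fhat_eq_0_imp_eq_0:
  assumes h: "torus_continuous h" and zero: "\<And>k. fhat h k = 0"
  shows "h x = 0"
proof (rule torus_mean_faithful[OF h])
  have trig0: "torus_mean (\<lambda>x. h x * p x) = 0" if "p \<in> trig_poly" for p
    using that
  proof (induction rule: trig_poly.induct)
    case (monomial c k)
    have "torus_mean (\<lambda>x. c * (h x * chi k x)) = 0"
      using zero[of "-k"] by (simp add: torus_mean_cmult fhat_def)
    then show ?case by (simp add: mult_ac)
  next
    case (add f g)
    have "torus_continuous (\<lambda>x. h x * f x)" "torus_continuous (\<lambda>x. h x * g x)"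
      by (intro torus_continuous_intros h torus_continuous_test trig_test add.hyps)+
    then show ?case using add.IH by (simp add: distrib_left torus_mean_add)
  qed
  obtain B where B: "B \<ge> 0" "\<And>x. cmod (h x) \<le> B" using torus_continuous_bounded[OF h] by metis
  have "cmod (torus_mean (\<lambda>x. h x * cnj (h x))) \<le> e" if e: "e > 0" for e
  proof -
    have "e / (B + 1) > 0" using e B by simp
    then obtain p where p: "p \<in> trig_poly" "\<And>x. cmod (cnj (h x) - p x) < e / (B + 1)"
      using trig_dense_uniform[OF torus_continuous_cnj[OF h]] by metis
    have 2: "torus_continuous (\<lambda>x. h x * (cnj (h x) - p x))" "torus_continuous (\<lambda>x. h x * p x)"
      by (intro torus_continuous_intros h torus_continuous_test trig_test p(1))+
    have "torus_mean (\<lambda>x. h x * cnj (h x)) = torus_mean (\<lambda>x. h x * (cnj (h x) - p x) + h x * p x)"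
      by (simp add: algebra_simps)
    also have "\<dots> = torus_mean (\<lambda>x. h x * (cnj (h x) - p x))"
      using torus_mean_add[OF 2] trig0[OF p(1)] by simp
    also have "cmod \<dots> \<le> e"
    proof (rule torus_mean_bound)
      fix x
      have "cmod (h x * (cnj (h x) - p x)) \<le> B * (e / (B + 1))"
        unfolding norm_mult using B p(2)[of x] by (intro mult_mono) auto
      also have "\<dots> \<le> e" using B e by (simp add: field_simps)
      finally show "cmod (h x * (cnj (h x) - p x)) \<le> e" .
    qed
    finally show ?thesis .
  qed
  then show "torus_mean (\<lambda>x. h x * cnj (h x)) = 0"
    using field_le_epsilon[of "cmod (torus_mean (\<lambda>x. h x * cnj (h x)))" 0] by simp
qed

text \<open>
  Integration by parts: the partial derivative of \<open>f(x) exp (- 2 \<pi> i k \<bullet> x)\<close> has mean \<open>0\<close>.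
\<close>

lemma fhat_partial:
  assumes f: "f \<in> test_functions"
  shows "fhat (partial i f) k = 2 * complex_of_real pi * \<i> * of_int (k $ i) * fhat f k"
proof -
  let ?b = "axis i 1 :: real^'a"
  let ?c = "2 * complex_of_real pi * \<i> * of_int (k $ i)"
  have fk: "torus_continuous (\<lambda>x. f x * chi (- k) x)"
    and pk: "torus_continuous (\<lambda>x. partial i f x * chi (- k) x)"
    by (intro torus_continuous_intros torus_continuous_test f partial_test)+
  have cfk: "torus_continuous (\<lambda>x. (- ?c) * (f x * chi (- k) x))"
    by (intro torus_continuous_mult torus_continuous_const fk)
  let ?g = "\<lambda>x. (- ?c) * (f x * chi (- k) x) + partial i f x * chi (- k) x"
  have g: "torus_continuous ?g"
    by (intro torus_continuous_add cfk pk)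
  obtain B where B: "\<And>x. cmod (?g x) \<le> B" using torus_continuous_bounded[OF g] by metis
  have fk': "lattice_periodic (\<lambda>x. f x * chi (- k) x)" and g': "continuous_on UNIV ?g"
    using fk g by (auto simp: torus_continuous_def)
  obtain l where l: "?b = rvec l" using Basis_rvec[of ?b] by auto
  have "torus_mean ?g = 0"
    unfolding torus_mean_def
  proof (rule cube_avg_directional_derivative[where j = ?b and v = "\<lambda>b. b" and g = ?g and k = l and B = B
        and f = "\<lambda>x. f x * chi (- k) x" and f' = "\<lambda>x h. f x * (2 * complex_of_real pi * \<i>
          * complex_of_real (rvec (- k) \<bullet> h) * chi (- k) x) + frechet_derivative f (at x) h * chi (- k) x"])
    have "(f has_derivative frechet_derivative f (at x)) (at x)" for x
      using smooth_differentiable[OF test_functionsD(1)[OF f]] frechet_derivative_works by blast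
    then show "((\<lambda>x. f x * chi (- k) x) has_derivative (\<lambda>h. f x * (2 * complex_of_real pi * \<i>
        * complex_of_real (rvec (- k) \<bullet> h) * chi (- k) x) + frechet_derivative f (at x) h * chi (- k) x)) (at x)" for x
      by (rule has_derivative_mult[OF _ chi_has_derivative])
    show "?g x = f x * (2 * complex_of_real pi * \<i> * complex_of_real (rvec (- k) \<bullet> ?b) * chi (- k) x) +
         frechet_derivative f (at x) ?b * chi (- k) x" for x
      by (simp add: partial_def rvec_minus inner_axis)
    show "?b \<in> Basis" by simp
  qed (fact finite_Basis l fk' g' B)+
  then have "(- ?c) * fhat f k + fhat (partial i f) k = 0"
    by (simp only: torus_mean_add[OF cfk pk] torus_mean_cmult fhat_def)
  then show ?thesis by (simp add: add_eq_0_iff2)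
qed

lemma fhat_partials: "f \<in> test_functions \<Longrightarrow> fhat (partials js f) k = deriv_symbol js k * fhat f k"
  by (induction js) (auto simp: deriv_symbol_def fhat_partial partials_test)

lemma jbracket_ge_1: "jbracket k \<ge> 1"
  by (simp add: jbracket_def)

lemma jbracket_nonneg: "jbracket k \<ge> 0"
  using jbracket_ge_1[of k] by simp

lemma jbracket_minus [simp]: "jbracket (- k) = jbracket k"
  by (simp add: jbracket_def rvec_minus)

lemma abs_component_le_jbracket: "\<bar>real_of_int (k $ i)\<bar> \<le> jbracket k"
proof -
  have "\<bar>real_of_int (k $ i)\<bar> \<le> norm (rvec k)"
    using component_le_norm_cart[of "rvec k" i] by simp
  also have "\<dots> \<le> jbracket k"
    unfolding jbracket_def by (rule real_le_rsqrt) simp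
  finally show ?thesis .
qed

lemma norm_deriv_symbol_le: "cmod (deriv_symbol js k) \<le> (2 * pi * jbracket k) ^ length js"
proof (induction js)
  case (Cons i js)
  have "cmod (deriv_symbol (i # js) k) = (2 * pi * \<bar>real_of_int (k $ i)\<bar>) * cmod (deriv_symbol js k)"
    by (simp add: deriv_symbol_def norm_mult)
  also have "\<dots> \<le> (2 * pi * jbracket k) * (2 * pi * jbracket k) ^ length js"
    using Cons abs_component_le_jbracket[of k i] jbracket_ge_1[of k]
    by (intro mult_mono) auto
  finally show ?case by simp
qed (simp add: deriv_symbol_def)

lemma norm_deriv_symbol_le':
  assumes "length js \<le> N" shows "cmod (deriv_symbol js k) \<le> (2 * pi * jbracket k) ^ N"
proof -
  have "1 * 1 \<le> (2 * pi) * jbracket k"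
    using jbracket_ge_1 pi_gt3 by (intro mult_mono) auto
  then show ?thesis
    using norm_deriv_symbol_le[of js k] power_increasing[OF assms, of "2 * pi * jbracket k"] by simp
qed

lemma fhat_bound: "f \<in> test_functions \<Longrightarrow> length js \<le> M \<Longrightarrow> cmod (deriv_symbol js k * fhat f k) \<le> CN_norm M f"
  unfolding fhat_partials[symmetric]
  unfolding fhat_def by (rule torus_mean_bound) (simp add: norm_mult CN_norm_upper)

text \<open>
  The bound comes from \<open>M\<close> derivatives in the direction of the largest component of \<open>k\<close>, which is
  comparable with \<open>jbracket k\<close>. If no component exceeds \<open>1\<close> in modulus, then \<open>jbracket k\<close> is bounded
  by the constant and no derivative is taken.
\<close>

lemma fhat_decay:
  fixes f :: "real^'n::finite \<Rightarrow> complex"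
  assumes f: "f \<in> test_functions"
  shows "jbracket k ^ M * cmod (fhat f k) \<le> (1 + real CARD('n)) ^ M * CN_norm M f"
proof -
  let ?c = "1 + real CARD('n)"
  define m where "m = Max (range (\<lambda>i. \<bar>real_of_int (k $ i)\<bar>))"
  have m: "\<bar>real_of_int (k $ i)\<bar> \<le> m" for i by (simp add: m_def)
  have "jbracket k \<le> 1 + norm (rvec k)"
    unfolding jbracket_def by (rule real_le_lsqrt) (auto simp: power2_eq_square algebra_simps)
  also have "norm (rvec k) \<le> (\<Sum>i\<in>UNIV. \<bar>rvec k $ i\<bar>)" by (rule norm_le_l1_cart)
  also have "\<dots> \<le> (\<Sum>i\<in>(UNIV::'n set). m)" by (rule sum_mono) (simp add: m)
  finally have jb: "jbracket k \<le> 1 + real CARD('n) * m" by simp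
  have CN: "CN_norm M f \<ge> 0" by (rule CN_norm_nonneg[OF f])
  show ?thesis
  proof (cases "m \<le> 1")
    case True
    then have "real CARD('n) * m \<le> real CARD('n) * 1" by (intro mult_left_mono) auto
    then have "jbracket k \<le> ?c" using jb by linarith
    then have "jbracket k ^ M \<le> ?c ^ M" using jbracket_ge_1[of k] by (intro power_mono) auto
    moreover have "cmod (fhat f k) \<le> CN_norm M f"
      using fhat_bound[OF f, of "[]" M k] by (simp add: deriv_symbol_def)
    ultimately show ?thesis by (intro mult_mono) auto
  next
    case False
    have "m \<in> range (\<lambda>i. \<bar>real_of_int (k $ i)\<bar>)" unfolding m_def by (rule Max_in) auto
    then obtain i where i: "m = \<bar>real_of_int (k $ i)\<bar>" by blast
    have "jbracket k \<le> ?c * m" using jb False by (simp add: algebra_simps)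
    then have "jbracket k ^ M \<le> (?c * m) ^ M" using jbracket_ge_1[of k] by (intro power_mono) auto
    then have "jbracket k ^ M * cmod (fhat f k) \<le> (?c * m) ^ M * cmod (fhat f k)"
      by (intro mult_right_mono) auto
    also have "\<dots> = ?c ^ M * (m ^ M * cmod (fhat f k))" by (simp add: power_mult_distrib)
    also have "m ^ M * cmod (fhat f k) \<le> (2 * pi * m) ^ M * cmod (fhat f k)"
    proof -
      have "1 * m \<le> (2 * pi) * m" using pi_gt3 False by (intro mult_right_mono) auto
      then show ?thesis using False by (intro mult_right_mono power_mono) auto
    qed
    also have "(2 * pi * m) ^ M * cmod (fhat f k) = cmod (deriv_symbol (replicate M i) k * fhat f k)"
      by (simp add: deriv_symbol_def i norm_mult norm_power)
    also have "\<dots> \<le> CN_norm M f" by (rule fhat_bound[OF f]) simp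
    finally show ?thesis by (simp add: mult_left_mono)
  qed
qed

lemma summable_inverse_1_plus_square_int: "(\<lambda>j::int. inverse (1 + (real_of_int j)\<^sup>2)) summable_on UNIV"
proof -
  let ?a = "\<lambda>j::int. inverse (1 + (real_of_int j)\<^sup>2)"
  have "summable (\<lambda>n. inverse (real (Suc n) ^ 2))"
    by (rule iffD2[OF summable_Suc_iff[of "\<lambda>n. inverse (real n ^ 2)"] inverse_power_summable]) simp
  then have "summable (\<lambda>n. norm (2 * inverse (real (Suc n) ^ 2)))"
    by (simp add: summable_mult)
  then have "summable (\<lambda>n. norm (?a (int n)))"
  proof (rule summable_comparison_test[rotated], intro exI allI impI)
    fix n :: nat
    \<comment> \<open>Equivalent to \<open>(1 + n)\<^sup>2 \<le> 2 (1 + n\<^sup>2)\<close>, which gives the factor \<open>2\<close> of the majorant.\<close>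
    have "(real n - 1)\<^sup>2 \<ge> 0" by simp
    then have "(1 + real n)\<^sup>2 \<le> 2 * (1 + (real n)\<^sup>2)" by (simp add: power2_eq_square algebra_simps)
    then show "norm (norm (?a (int n))) \<le> norm (2 * inverse (real (Suc n) ^ 2))"
      by (simp add: field_simps add_pos_nonneg)
  qed
  then have nat: "(\<lambda>n::nat. ?a (int n)) summable_on UNIV" by (rule norm_summable_imp_summable_on)
  have "?a summable_on range int"
    using nat by (subst summable_on_reindex) (auto simp: o_def)
  moreover have "?a summable_on range (\<lambda>n. - int n)"
    using nat by (subst summable_on_reindex) (auto simp: o_def inj_on_def)
  moreover have "range int \<union> range (\<lambda>n. - int n) = UNIV"
  proof -
    have "j \<in> range int \<union> range (\<lambda>n. - int n)" for j by (cases j rule: int_cases2) auto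
    then show ?thesis by blast
  qed
  ultimately show ?thesis using summable_on_union by fastforce
qed

text \<open>
  A finite set of lattice points lies in the box of its coordinate projections, over which the sum
  factors.
\<close>

lemma summable_prod_components:
  fixes a :: "int \<Rightarrow> real"
  assumes "a summable_on UNIV" "\<And>j. a j \<ge> 0"
  shows "(\<lambda>k::int^'n::finite. \<Prod>i\<in>UNIV. a (k $ i)) summable_on UNIV"
proof (rule nonneg_bdd_above_summable_on)
  show "(\<Prod>i\<in>UNIV. a (k $ i)) \<ge> 0" for k :: "int^'n" by (simp add: prod_nonneg assms)
  show "bdd_above (sum (\<lambda>k::int^'n. \<Prod>i\<in>UNIV. a (k $ i)) ` {F. F \<subseteq> UNIV \<and> finite F})"
  proof (rule bdd_aboveI2, clarify)
    fix F :: "(int^'n) set" assume F: "finite F"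
    let ?P = "PiE UNIV (\<lambda>i. (\<lambda>k. k $ i) ` F)"
    have "(\<Sum>k\<in>F. \<Prod>i\<in>UNIV. a (k $ i)) = (\<Sum>g\<in>vec_nth ` F. \<Prod>i\<in>UNIV. a (g i))"
      by (subst sum.reindex) (auto simp: inj_on_def vec_nth_inject)
    also have "\<dots> \<le> (\<Sum>g\<in>?P. \<Prod>i\<in>UNIV. a (g i))"
      by (rule sum_mono2) (auto simp: F finite_PiE prod_nonneg assms)
    also have "\<dots> = (\<Prod>i\<in>(UNIV::'n set). \<Sum>j\<in>(\<lambda>k. k $ i) ` F. a j)"
      by (rule prod_sum_PiE[symmetric]) (auto simp: F)
    also have "\<dots> \<le> (\<Prod>i\<in>(UNIV::'n set). infsum a UNIV)"
      by (rule prod_mono) (auto simp: F assms intro!: sum_nonneg finite_sum_le_infsum)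
    finally show "(\<Sum>k\<in>F. \<Prod>i\<in>UNIV. a (k $ i)) \<le> (\<Prod>i\<in>(UNIV::'n set). infsum a UNIV)" .
  qed
qed

text \<open>
  Each factor \<open>1 + k\<^sub>i\<^sup>2\<close> is at most the square of \<open>jbracket k\<close>, so the power \<open>2 n\<close> dominates
  the product of the \<open>n\<close> factors.
\<close>

lemma summable_jbracket: "(\<lambda>k::int^'n::finite. inverse (jbracket k ^ (2 * CARD('n)))) summable_on UNIV"
proof (rule summable_on_comparison_test)
  let ?a = "\<lambda>j::int. inverse (1 + (real_of_int j)\<^sup>2)"
  show "(\<lambda>k::int^'n. \<Prod>i\<in>UNIV. ?a (k $ i)) summable_on UNIV"
    by (rule summable_prod_components[OF summable_inverse_1_plus_square_int]) simp
  fix k :: "int^'n"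
  have "1 + (real_of_int (k $ i))\<^sup>2 \<le> jbracket k ^ 2" for i
    using power_mono[OF component_le_norm_cart[of "rvec k" i], of 2] by (simp add: jbracket_def)
  then have "(\<Prod>i\<in>(UNIV::'n set). 1 + (real_of_int (k $ i))\<^sup>2) \<le> (\<Prod>i\<in>(UNIV::'n set). jbracket k ^ 2)"
    by (intro prod_mono) auto
  moreover have "(\<Prod>i\<in>(UNIV::'n set). 1 + (real_of_int (k $ i))\<^sup>2) > 0"
    by (rule prod_pos) (simp add: add_pos_nonneg)
  ultimately have "inverse (jbracket k ^ (2 * CARD('n))) \<le> inverse (\<Prod>i\<in>(UNIV::'n set). 1 + (real_of_int (k $ i))\<^sup>2)"
    by (intro le_imp_inverse_le) (auto simp: power_mult)
  then show "inverse (jbracket k ^ (2 * CARD('n))) \<le> (\<Prod>i\<in>(UNIV::'n set). ?a (k $ i))"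
    by (simp add: prod_inversef[symmetric] o_def)
  show "0 \<le> inverse (jbracket k ^ (2 * CARD('n)))"
    using jbracket_ge_1[of k] by simp
qed

lemma fhat_decay_summable_form:
  fixes f :: "real^'n::finite \<Rightarrow> complex"
  assumes f: "f \<in> test_functions"
  shows "jbracket k ^ N * cmod (fhat f k) \<le>
    ((1 + real CARD('n)) ^ (N + 2 * CARD('n)) * CN_norm (N + 2 * CARD('n)) f) * inverse (jbracket k ^ (2 * CARD('n)))"
  using fhat_decay[OF f, of k "N + 2 * CARD('n)"] jbracket_ge_1[of k]
  by (simp add: field_simps power_add)

lemma fhat_weighted_summable:
  assumes f: "f \<in> test_functions"
  shows "(\<lambda>k. jbracket k ^ N * cmod (fhat f k)) summable_on UNIV"
  by (rule summable_on_comparison_test[OF summable_on_cmult_right[OF summable_jbracket] fhat_decay_summable_form[OF f]])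
    (simp add: jbracket_nonneg)

text \<open>
  The series converges uniformly to a continuous function \<open>S\<close> with the Fourier coefficients of
  \<open>f\<close>, and a continuous function with zero coefficients vanishes.
\<close>

lemma Fourier_inversion:
  assumes f: "f \<in> test_functions"
  shows "((\<lambda>k. fhat f k * chi k x) has_sum f x) UNIV"
proof -
  define S where "S x = (\<Sum>\<^sub>\<infinity>k. fhat f k * chi k x)" for x
  have sum: "(\<lambda>k. cmod (fhat f k)) summable_on UNIV"
    using fhat_weighted_summable[OF f, of 0] by simp
  have unif: "uniform_limit UNIV (\<lambda>F x. \<Sum>k\<in>F. fhat f k * chi k x) S (finite_subsets_at_top UNIV)"
    unfolding S_def by (rule Weierstrass_m_test_general[OF _ sum]) (simp add: norm_mult)
  have "continuous_on UNIV S"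
    by (rule uniform_limit_theorem[OF _ unif])
      (use torus_continuous_chi in \<open>auto simp: torus_continuous_def intro!: always_eventually continuous_intros\<close>)
  moreover have "lattice_periodic S"
    by (simp add: S_def lattice_periodic_def chi_add_arg)
  ultimately have S: "torus_continuous S" by (simp add: torus_continuous_def)
  have h: "torus_continuous (\<lambda>x. f x - S x)" by (intro torus_continuous_intros torus_continuous_test f S)
  have "fhat (\<lambda>x. f x - S x) j = 0" for j
  proof -
    have "cmod (fhat (\<lambda>x. f x - S x) j) \<le> e" if e: "e > 0" for e
    proof -
      have "\<forall>\<^sub>F F in finite_subsets_at_top UNIV. \<forall>x\<in>UNIV. dist (\<Sum>k\<in>F. fhat f k * chi k x) (S x) < e"
        using unif e by (simp add: uniform_limit_iff)
      then obtain F0 where F0: "finite F0"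
        "\<And>F x. finite F \<Longrightarrow> F0 \<subseteq> F \<Longrightarrow> dist (\<Sum>k\<in>F. fhat f k * chi k x) (S x) < e"
        unfolding eventually_finite_subsets_at_top by auto
      \<comment> \<open>Once \<open>j\<close> belongs to \<open>F\<close>, the partial sum has the \<open>j\<close>-th coefficient of \<open>f\<close>.\<close>
      define F where "F = insert j F0"
      have F: "finite F" "j \<in> F" "\<And>x. cmod ((\<Sum>k\<in>F. fhat f k * chi k x) - S x) < e"
        using F0(1) F0(2)[of F] by (auto simp: F_def dist_norm)
      let ?P = "\<lambda>x. \<Sum>k\<in>F. fhat f k * chi k x"
      have mean_P: "torus_mean (\<lambda>x. \<Sum>k\<in>G. fhat f k * chi k x * chi (- j) x) = (\<Sum>k\<in>G. fhat f k * (if k = j then 1 else 0))"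
        if "finite G" for G
        using that
      proof (induction G rule: finite_induct)
        case empty
        show ?case using torus_mean_cmult[of 0 "\<lambda>_. 0"] by simp
      next
        case (insert a G)
        have "torus_mean (\<lambda>x. fhat f a * chi a x * chi (- j) x) = fhat f a * (if a = j then 1 else 0)"
          by (simp add: mult.assoc chi_mult torus_mean_cmult torus_mean_chi)
        moreover have "torus_continuous (\<lambda>x. fhat f a * chi a x * chi (- j) x)"
          "torus_continuous (\<lambda>x. \<Sum>k\<in>G. fhat f k * chi k x * chi (- j) x)"
          by (intro torus_continuous_intros)+
        ultimately show ?case using insert by (simp add: torus_mean_add)
      qed
      have c1: "torus_continuous (\<lambda>x. f x * chi (- j) x)"
        by (intro torus_continuous_intros torus_continuous_test f)
      have c2: "torus_continuous (\<lambda>x. (-1) * (\<Sum>k\<in>F. fhat f k * chi k x * chi (- j) x))"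
        by (intro torus_continuous_intros)
      have c3: "torus_continuous (\<lambda>x. (?P x - S x) * chi (- j) x)"
        by (intro torus_continuous_intros S)
      have "fhat (\<lambda>x. f x - S x) j
        = torus_mean (\<lambda>x. (f x * chi (- j) x + (-1) * (\<Sum>k\<in>F. fhat f k * chi k x * chi (- j) x)) + (?P x - S x) * chi (- j) x)"
        unfolding fhat_def
        by (rule arg_cong[of _ _ torus_mean]) (simp add: fun_eq_iff left_diff_distrib sum_distrib_right)
      also have "\<dots> = (fhat f j + (-1) * (\<Sum>k\<in>F. fhat f k * (if k = j then 1 else 0))) + torus_mean (\<lambda>x. (?P x - S x) * chi (- j) x)"
        unfolding torus_mean_add[OF torus_continuous_add[OF c1 c2] c3] torus_mean_add[OF c1 c2]
          torus_mean_cmult mean_P[OF F(1)] by (simp add: fhat_def)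
      also have "\<dots> = torus_mean (\<lambda>x. (?P x - S x) * chi (- j) x)"
        using F(1,2) by (simp add: if_distrib[of "(*) _"] cong: if_cong)
      also have "cmod \<dots> \<le> e"
        by (rule torus_mean_bound) (use F(3) in \<open>auto simp: norm_mult less_imp_le\<close>)
      finally show ?thesis .
    qed
    then show ?thesis
      using field_le_epsilon[of "cmod (fhat (\<lambda>x. f x - S x) j)" 0] by simp
  qed
  from fhat_eq_0_imp_eq_0[OF h this] have "f x = S x" by simp
  moreover have "(\<lambda>k. fhat f k * chi k x) summable_on UNIV"
    by (rule abs_summable_summable) (use sum in \<open>simp add: norm_mult\<close>)
  ultimately show ?thesis by (simp add: S_def)
qed

lemma summable_tail_small:
  fixes a :: "'a \<Rightarrow> real"
  assumes "a summable_on UNIV" "e > 0"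
  obtains F where "finite F" "infsum a (UNIV - F) \<le> e"
proof -
  have "(sum a \<longlongrightarrow> infsum a UNIV) (finite_subsets_at_top UNIV)"
    using has_sum_infsum[OF assms(1)] by (simp add: has_sum_def)
  then have "\<forall>\<^sub>F F in finite_subsets_at_top UNIV. dist (sum a F) (infsum a UNIV) < e"
    using assms(2) tendstoD by blast
  then obtain F where F: "finite F" "dist (sum a F) (infsum a UNIV) < e"
    unfolding eventually_finite_subsets_at_top by blast
  have "a summable_on (UNIV - F)" using assms(1) summable_on_subset_banach by blast
  then have "infsum a UNIV = infsum a F + infsum a (UNIV - F)"
    using infsum_Un_disjoint[of a F "UNIV - F"] F(1) by simp
  then have "infsum a (UNIV - F) \<le> e" using F by (simp add: dist_real_def)
  then show thesis using that F(1) by blast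
qed

lemma test_diff: "f \<in> test_functions \<Longrightarrow> g \<in> test_functions \<Longrightarrow> (\<lambda>x. f x - g x) \<in> test_functions"
  using test_add[of f "\<lambda>x. (-1) * g x"] test_cmult[of g "-1"] by simp

lemma partials_diff:
  assumes "f \<in> test_functions" "g \<in> test_functions"
  shows "partials js (\<lambda>x. f x - g x) = (\<lambda>x. partials js f x - partials js g x)"
  using partials_add[of f "\<lambda>x. (-1) * g x" js] partials_cmult[of g js "-1"]
    assms[THEN test_functionsD(1)] test_functionsD(1)[OF test_cmult[OF assms(2), of "-1"]] by simp

text \<open>
  The Fourier series of each derivative is the termwise derivative of that of \<open>f\<close>. The tails of
  all derivatives of order at most \<open>N\<close> share one summable majorant, so one finite set of
  frequencies serves all of them.
\<close>

lemma Fourier_partial_sums_dense: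
  assumes f: "f \<in> test_functions" and e: "e > 0"
  obtains F where "finite F" "CN_norm N (\<lambda>x. f x - (\<Sum>k\<in>F. fhat f k * chi k x)) \<le> e"
proof -
  let ?a = "\<lambda>k. (2 * pi) ^ N * (jbracket k ^ N * cmod (fhat f k))"
  have a: "?a summable_on UNIV"
    by (intro summable_on_cmult_right fhat_weighted_summable f)
  obtain F where F: "finite F" "infsum ?a (UNIV - F) \<le> e"
    by (rule summable_tail_small[OF a e])
  let ?P = "\<lambda>x. \<Sum>k\<in>F. fhat f k * chi k x"
  have P: "?P \<in> test_functions" by (intro test_sum test_cmult chi_test F)
  have "CN_norm N (\<lambda>x. f x - ?P x) \<le> e"
  proof (rule CN_norm_least)
    fix js :: "'a list" and x assume js: "length js \<le> N"
    let ?b = "\<lambda>k. fhat (partials js f) k * chi k x"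
    have "partials js ?P = (\<lambda>x. \<Sum>k\<in>F. partials js (\<lambda>x. fhat f k * chi k x) x)"
      by (intro partials_sum F(1) test_cmult chi_test)
    then have "partials js ?P x = (\<Sum>k\<in>F. ?b k)"
      by (simp add: partials_cmult[OF smooth_chi] chi_partials fhat_partials[OF f] mult.assoc mult.left_commute)
    moreover have "(?b has_sum (partials js f x)) UNIV"
      by (intro Fourier_inversion partials_test f)
    ultimately have "(?b has_sum (partials js f x - partials js ?P x)) (UNIV - F)"
      using has_sum_Diff[OF _ has_sum_finite[OF F(1), of ?b]] by simp
    moreover have "(?a has_sum infsum ?a (UNIV - F)) (UNIV - F)"
      using a summable_on_subset_banach has_sum_infsum by blast
    ultimately have "cmod (partials js f x - partials js ?P x) \<le> infsum ?a (UNIV - F)"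
    proof (rule norm_infsum_le)
      fix k
      show "cmod (?b k) \<le> ?a k"
        using mult_right_mono[OF norm_deriv_symbol_le'[OF js, of k], of "cmod (fhat f k)"]
        by (simp add: fhat_partials f norm_mult power_mult_distrib mult_ac)
    qed
    then show "cmod (partials js (\<lambda>x. f x - ?P x) x) \<le> e"
      using F(2) by (simp add: partials_diff[OF f P])
  qed
  then show thesis using that F(1) by blast
qed

section \<open>Distributions and their Fourier coefficients\<close>

definition poly_growth :: "(int^'n::finite \<Rightarrow> complex) \<Rightarrow> bool" where
  "poly_growth c \<longleftrightarrow> (\<exists>C N. \<forall>k. cmod (c k) \<le> C * jbracket k ^ N)"

lemma distributions_add:
  "u \<in> distributions \<Longrightarrow> f \<in> test_functions \<Longrightarrow> g \<in> test_functions \<Longrightarrow> u (\<lambda>x. f x + g x) = u f + u g"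
  and distributions_cmult: "u \<in> distributions \<Longrightarrow> f \<in> test_functions \<Longrightarrow> u (\<lambda>x. c * f x) = c * u f"
  by (auto simp: distributions_def)

lemma distributions_diff:
  "u \<in> distributions \<Longrightarrow> f \<in> test_functions \<Longrightarrow> g \<in> test_functions \<Longrightarrow> u (\<lambda>x. f x - g x) = u f - u g"
  using distributions_add[of u f "\<lambda>x. (-1) * g x"] distributions_cmult[of u g "-1"] test_cmult[of g "-1"] by simp

lemma distributions_sum:
  assumes u: "u \<in> distributions"
  shows "finite F \<Longrightarrow> (\<And>k. k \<in> F \<Longrightarrow> f k \<in> test_functions) \<Longrightarrow> u (\<lambda>x. \<Sum>k\<in>F. f k x) = (\<Sum>k\<in>F. u (f k))"
proof (induction F rule: finite_induct)
  case empty
  show ?case using distributions_cmult[OF u chi_test, of 0 0] by simp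
next
  case (insert a F)
  then show ?case using distributions_add[OF u, of "f a"] test_sum[of F f] by simp
qed

lemma distributions_bound:
  assumes "u \<in> distributions"
  obtains C N where "C \<ge> 0" "\<And>f. f \<in> test_functions \<Longrightarrow> cmod (u f) \<le> C * CN_norm N f"
proof -
  obtain C N where "\<forall>f\<in>test_functions. cmod (u f) \<le> C * CN_norm N f"
    using assms unfolding distributions_def by blast
  then have C: "\<And>f. f \<in> test_functions \<Longrightarrow> cmod (u f) \<le> C * CN_norm N f" by blast
  have "cmod (u f) \<le> \<bar>C\<bar> * CN_norm N f" if "f \<in> test_functions" for f
    using C[OF that] mult_right_mono[OF abs_ge_self[of C] CN_norm_nonneg[OF that, of N]] by linarith
  then show thesis using that[of "\<bar>C\<bar>"] by auto
qed

text \<open>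
  Both functionals agree on trigonometric polynomials, and these are dense in the \<open>C\<^sup>N\<close> norm that
  controls the two of them.
\<close>

lemma distribution_eqI:
  assumes u: "u \<in> distributions" and v: "v \<in> distributions" and eq: "\<And>k. fcoeff u k = fcoeff v k"
  shows "u = v"
proof (rule extensionalityI)
  show "u \<in> extensional test_functions" "v \<in> extensional test_functions"
    using u v by (auto simp: distributions_def)
  fix f :: "real^'a \<Rightarrow> complex" assume f: "f \<in> test_functions"
  obtain C1 N1 where C1: "C1 \<ge> 0" "\<And>f. f \<in> test_functions \<Longrightarrow> cmod (u f) \<le> C1 * CN_norm N1 f"
    using distributions_bound[OF u] by metis
  obtain C2 N2 where C2: "C2 \<ge> 0" "\<And>f. f \<in> test_functions \<Longrightarrow> cmod (v f) \<le> C2 * CN_norm N2 f"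
    using distributions_bound[OF v] by metis
  define N where "N = max N1 N2"
  have chi_eq: "u (chi k) = v (chi k)" for k
    using eq[of "-k"] by (simp add: fcoeff_chi)
  have "cmod (u f - v f) \<le> e" if e: "e > 0" for e
  proof -
    \<comment> \<open>The summand \<open>1\<close> covers the case in which both constants vanish.\<close>
    have "e / (C1 + C2 + 1) > 0" using e C1(1) C2(1) by simp
    then obtain F where F: "finite F" "CN_norm N (\<lambda>x. f x - (\<Sum>k\<in>F. fhat f k * chi k x)) \<le> e / (C1 + C2 + 1)"
      by (rule Fourier_partial_sums_dense[OF f])
    let ?P = "\<lambda>x. \<Sum>k\<in>F. fhat f k * chi k x"
    have P: "?P \<in> test_functions" by (intro test_sum test_cmult chi_test F)
    have "u ?P = v ?P"
      by (simp add: distributions_sum[OF u F(1)] distributions_sum[OF v F(1)] test_cmult chi_test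
          distributions_cmult[OF u] distributions_cmult[OF v] chi_eq)
    then have "u f - v f = u (\<lambda>x. f x - ?P x) - v (\<lambda>x. f x - ?P x)"
      by (simp add: distributions_diff[OF u f P] distributions_diff[OF v f P])
    also have "cmod \<dots> \<le> cmod (u (\<lambda>x. f x - ?P x)) + cmod (v (\<lambda>x. f x - ?P x))"
      by (rule norm_triangle_ineq4)
    also have "\<dots> \<le> C1 * (e / (C1 + C2 + 1)) + C2 * (e / (C1 + C2 + 1))"
    proof (rule add_mono)
      have d: "(\<lambda>x. f x - ?P x) \<in> test_functions" by (rule test_diff[OF f P])
      show "cmod (u (\<lambda>x. f x - ?P x)) \<le> C1 * (e / (C1 + C2 + 1))"
        using C1(2)[OF d] mult_left_mono[OF order_trans[OF CN_norm_mono[OF d, of N1 N] F(2)] C1(1)]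
        by (simp add: N_def)
      show "cmod (v (\<lambda>x. f x - ?P x)) \<le> C2 * (e / (C1 + C2 + 1))"
        using C2(2)[OF d] mult_left_mono[OF order_trans[OF CN_norm_mono[OF d, of N2 N] F(2)] C2(1)]
        by (simp add: N_def)
    qed
    also have "\<dots> = (C1 + C2) * (e / (C1 + C2 + 1))" by (rule distrib_right[symmetric])
    also have "\<dots> \<le> e" using C1(1) C2(1) e by (simp add: field_simps)
    finally show ?thesis .
  qed
  then show "u f = v f" using field_le_epsilon[of "cmod (u f - v f)" 0] by simp
qed

lemma fcoeff_poly_growth:
  assumes "u \<in> distributions"
  shows "poly_growth (fcoeff u)"
proof -
  obtain C N where C: "C \<ge> 0" "\<And>f. f \<in> test_functions \<Longrightarrow> cmod (u f) \<le> C * CN_norm N f"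
    using distributions_bound[OF assms] by metis
  have "cmod (fcoeff u k) \<le> (C * (2 * pi) ^ N) * jbracket k ^ N" for k
  proof -
    have "CN_norm N (chi (- k)) \<le> (2 * pi * jbracket k) ^ N"
      using norm_deriv_symbol_le'[of _ N "-k"] by (intro CN_norm_least) (simp add: chi_partials norm_mult)
    then have "C * CN_norm N (chi (- k)) \<le> C * (2 * pi * jbracket k) ^ N"
      using C(1) by (rule mult_left_mono)
    with C(2)[OF chi_test, of "-k"] show ?thesis
      by (simp add: fcoeff_chi power_mult_distrib mult_ac)
  qed
  then show ?thesis unfolding poly_growth_def by blast
qed

text \<open>
  Pairing with the Fourier series suggests \<open>u f = \<Sum>k. c (- k) * fhat f k\<close>: the sign appears because
  \<open>fcoeff u k\<close> is the value at the character with frequency \<open>- k\<close>. Rapid decay of \<open>fhat f\<close> against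
  the growth of \<open>c\<close> gives convergence and the seminorm bound.
\<close>

lemma distribution_with_coefficients:
  fixes c :: "int^'n::finite \<Rightarrow> complex"
  assumes "poly_growth c"
  obtains u where "u \<in> distributions" "\<And>k. fcoeff u k = c k"
proof -
  obtain C0 N where C0: "\<And>k. cmod (c k) \<le> C0 * jbracket k ^ N"
    using assms by (auto simp: poly_growth_def)
  define C where "C = \<bar>C0\<bar>"
  have C: "C \<ge> 0" "\<And>k. cmod (c k) \<le> C * jbracket k ^ N"
    using C0 by (auto simp: C_def jbracket_nonneg intro!: order_trans[OF C0] mult_right_mono)
  define u where "u = (\<lambda>f\<in>test_functions. \<Sum>\<^sub>\<infinity>k. c (- k) * fhat f k)"
  have le: "cmod (c (- k) * fhat f k) \<le> C * (jbracket k ^ N * cmod (fhat f k))" for f k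
    using mult_right_mono[OF C(2)[of "-k"], of "cmod (fhat f k)"] by (simp add: norm_mult mult.assoc)
  have abs: "(\<lambda>k. cmod (c (- k) * fhat f k)) summable_on UNIV" if "f \<in> test_functions" for f
    by (rule summable_on_comparison_test[OF summable_on_cmult_right[OF fhat_weighted_summable[OF that]] le]) simp
  note sm = abs_summable_summable[OF abs]
  have fhat_add: "fhat (\<lambda>x. f x + g x) k = fhat f k + fhat g k" if "f \<in> test_functions" "g \<in> test_functions" for f g k
    unfolding fhat_def distrib_right
    by (rule torus_mean_add) (intro torus_continuous_mult torus_continuous_chi torus_continuous_test that)+
  have fhat_cmult: "fhat (\<lambda>x. a * f x) k = a * fhat f k" for a f k
    by (simp add: fhat_def torus_mean_cmult mult.assoc)
  let ?M = "N + 2 * CARD('n)"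
  let ?Z = "\<Sum>\<^sub>\<infinity>k::int^'n. inverse (jbracket k ^ (2 * CARD('n)))"
  have "cmod (u f) \<le> (C * (1 + real CARD('n)) ^ ?M * ?Z) * CN_norm ?M f" if f: "f \<in> test_functions" for f
  proof -
    let ?K = "C * ((1 + real CARD('n)) ^ ?M * CN_norm ?M f)"
    have "cmod (u f) \<le> ?K * ?Z"
      unfolding u_def using f
    proof (simp, intro norm_infsum_le[OF has_sum_infsum[OF sm[OF f]] has_sum_cmult_right[OF has_sum_infsum[OF summable_jbracket]]])
      fix k
      show "cmod (c (- k) * fhat f k) \<le> ?K * inverse (jbracket k ^ (2 * CARD('n)))"
        using order_trans[OF le mult_left_mono[OF fhat_decay_summable_form[OF f, of k N] C(1)]]
        by (simp add: mult.assoc)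
    qed
    then show ?thesis by (simp add: mult_ac)
  qed
  then have "u \<in> distributions"
    unfolding distributions_def
    by (auto simp: u_def test_add test_cmult fhat_add fhat_cmult distrib_left infsum_add sm
        mult.left_commute infsum_cmult_right')
  moreover have "fcoeff u j = c j" for j
  proof -
    have "fhat (chi (- j)) k = (if k = - j then 1 else 0)" for k
      using eq_neg_iff_add_eq_0[of "- j" "- k"] by (auto simp: fhat_def chi_mult torus_mean_chi)
    then have "fcoeff u j = (\<Sum>\<^sub>\<infinity>k. if k = - j then c (- k) else 0)"
      by (simp add: fcoeff_chi u_def chi_test if_distrib[of "(*) _"] cong: if_cong)
    also have "\<dots> = (\<Sum>\<^sub>\<infinity>k\<in>{- j}. c (- k))"
      by (rule infsum_cong_neutral) auto
    finally show ?thesis by simp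
  qed
  ultimately show thesis using that by blast
qed

lemma fourier_multiplier_eqI:
  assumes "v \<in> distributions" "\<And>k. fcoeff v k = \<omega> k * fcoeff u k"
  shows "fourier_multiplier \<omega> u = v"
  unfolding fourier_multiplier_def
  by (rule the_equality) (use assms in \<open>auto intro: distribution_eqI\<close>)

lemma radon_star_eqI:
  assumes "v \<in> distributions"
    "\<And>k. ((\<lambda>A. complex_of_real ((w k A)\<^sup>2) * fcoeff (g A) k) has_sum fcoeff v k) (Omega d k)"
  shows "radon_star d w g = v"
  unfolding radon_star_def
proof (rule the_equality)
  fix u assume u: "u \<in> distributions \<and>
    (\<forall>k. ((\<lambda>A. complex_of_real ((w k A)\<^sup>2) * fcoeff (g A) k) has_sum fcoeff u k) (Omega d k))"
  show "u = v"
    by (rule distribution_eqI) (use u assms has_sum_unique in blast)+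
qed (use assms in blast)

section \<open>Rational planes and integer bases\<close>

lemma common_denominator:
  fixes x :: "rat^'n::finite"
  obtains m :: int and z where "m \<noteq> 0" "qvec z = of_int m *s x"
proof -
  have "\<forall>i. \<exists>a b. b > 0 \<and> x $ i = of_int a / of_int b"
    by (metis quotient_of_denom_pos' quotient_of_div surj_pair snd_conv)
  then obtain a b where ab: "\<And>i. b i > 0" "\<And>i. x $ i = of_int (a i) / of_int (b i)" by metis
  define m where "m = prod b UNIV"
  define z :: "int^'n" where "z = (\<chi> i. a i * prod b (UNIV - {i}))"
  have m: "m = b i * prod b (UNIV - {i})" for i
    unfolding m_def by (rule prod.remove) auto
  have "m > 0" unfolding m_def by (rule prod_pos) (simp add: ab(1))
  then have "m \<noteq> 0" by simp
  moreover have "qvec z $ i = (of_int m *s x) $ i" for i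
    using ab[of i] by (subst m[of i]) (simp add: qvec_def z_def)
  ultimately show thesis using that by (metis vec_eq_iff)
qed

text \<open>
  A basis of \<open>A\<close> over the rationals is scaled to integer vectors. The scaled family still spans
  \<open>A\<close>, and a spanning family of \<open>dim A\<close> vectors is a basis without repetitions.
\<close>

lemma integer_basis_exists:
  fixes A :: "(rat^'n::finite) set"
  assumes "A \<in> Gr d"
  obtains v where "integer_basis d A v"
proof -
  have A: "vec.subspace A" "vec.dim A = d" using assms by (auto simp: Gr_def)
  obtain B where B: "B \<subseteq> A" "vec.independent B" "A \<subseteq> vec.span B" "card B = d"
    using vec.basis_exists[of A] A(2) by metis
  have "finite B" using B(2) by (rule vec.finiteI_independent)
  then obtain b where b: "bij_betw b {..<d} B"
    using ex_bij_betw_nat_finite[of B] B(4) by (auto simp: atLeast0LessThan)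
  have "\<forall>i. \<exists>m z. m \<noteq> 0 \<and> qvec z = of_int m *s b i"
    using common_denominator by metis
  then obtain m v where mv: "\<And>i. m i \<noteq> 0" "\<And>i. qvec (v i) = of_int (m i) *s b i" by metis
  let ?V = "(\<lambda>i. qvec (v i)) ` {..<d}"
  have bA: "b i \<in> A" if "i < d" for i using that b B(1) by (auto simp: bij_betw_def)
  have V: "?V \<subseteq> A" using bA A(1) by (auto simp: mv(2) vec.subspace_scale)
  have "b i \<in> vec.span ?V" if "i < d" for i
  proof -
    have "b i = inverse (of_int (m i)) *s qvec (v i)" using mv(1)[of i] by (simp add: mv(2))
    moreover have "qvec (v i) \<in> vec.span ?V" using that by (intro vec.span_base) auto
    ultimately show ?thesis by (metis vec.span_scale)
  qed
  then have "B \<subseteq> vec.span ?V" using b by (auto simp: bij_betw_def)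
  then have "vec.span B \<subseteq> vec.span ?V" by (simp add: vec.span_minimal)
  then have AV: "A \<subseteq> vec.span ?V" using B(3) by blast
  have "d \<le> card ?V" using vec.dim_le_card[OF AV] A(2) by simp
  moreover have "card ?V \<le> d" using card_image_le[of "{..<d}" "\<lambda>i. qvec (v i)"] by simp
  ultimately have card: "card ?V = d" by simp
  then have "inj_on (\<lambda>i. qvec (v i)) {..<d}" by (intro eq_card_imp_inj_on) auto
  moreover have "vec.independent ?V"
    by (rule vec.card_le_dim_spanning[OF V AV]) (use card A(2) in auto)
  moreover have "vec.span ?V = A" using AV vec.span_minimal[OF V A(1)] by blast
  ultimately show thesis using that by (auto simp: integer_basis_def)
qed

lemma perp_iff_integer_basis:
  assumes "integer_basis d A v"
  shows "perp k A \<longleftrightarrow> (\<forall>i<d. rvec k \<bullet> rvec (v i) = 0)"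
proof -
  let ?V = "(\<lambda>i. qvec (v i)) ` {..<d}"
  let ?dot = "\<lambda>x. \<Sum>i\<in>UNIV. rat_of_int (k $ i) * x $ i"
  have A: "A = vec.span ?V" using assms by (simp add: integer_basis_def)
  have dot: "?dot (qvec l) = 0 \<longleftrightarrow> rvec k \<bullet> rvec l = 0" for l
    unfolding inner_rvec by (simp add: qvec_def flip: of_int_mult of_int_sum)
  have "?dot x = 0" if "x \<in> vec.span ?V" "\<forall>y\<in>?V. ?dot y = 0" for x
    using that(1)
  proof (induction rule: vec.span_induct_alt)
    case (step c y z)
    have "?dot (c *s y + z) = c * ?dot y + ?dot z"
      by (simp add: distrib_left sum.distrib sum_distrib_left mult_ac)
    then show ?case using step that(2) by simp
  qed simp
  then have "perp k A \<longleftrightarrow> (\<forall>y\<in>?V. ?dot y = 0)"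
    unfolding perp_def A by (meson vec.span_base)
  then show ?thesis by (auto simp: dot)
qed

text \<open>
  If \<open>k\<^sub>j \<noteq> 0\<close>, then the vectors \<open>e\<^sub>i - (k\<^sub>i / k\<^sub>j) e\<^sub>j\<close> with \<open>i \<noteq> j\<close> are orthogonal to \<open>k\<close>, and
  together with \<open>e\<^sub>j\<close> they span the whole space. So these \<open>n - 1\<close> vectors are independent, and any
  \<open>d\<close> of them span a plane of the required kind. For \<open>k = 0\<close> the convention \<open>0 / 0 = 0\<close> makes them
  the unit vectors, and the argument is the same.
\<close>

lemma Omega_nonempty:
  fixes k :: "int^'n::finite"
  assumes d: "d \<le> CARD('n) - 1"
  shows "Omega d k \<noteq> {}"
proof -
  obtain j where j: "k \<noteq> 0 \<Longrightarrow> k $ j \<noteq> 0" by (metis vec_eq_iff zero_index)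
  define c where "c i = rat_of_int (k $ i) / rat_of_int (k $ j)" for i
  define u :: "'n \<Rightarrow> rat^'n" where "u i = axis i 1 - c i *s axis j 1" for i
  let ?S = "u ` (UNIV - {j})"
  let ?B = "insert (axis j 1) ?S"
  have "axis i 1 \<in> vec.span ?B" for i
  proof (cases "i = j")
    case True
    then show ?thesis by (simp add: vec.span_base)
  next
    case False
    have "u i + c i *s axis j 1 \<in> vec.span ?B"
      using False by (intro vec.span_add vec.span_scale vec.span_base) auto
    then show ?thesis by (simp add: u_def)
  qed
  then have "cart_basis \<subseteq> vec.span ?B" by (auto simp: cart_basis_def)
  then have "vec.span cart_basis \<subseteq> vec.span ?B" by (rule vec.span_minimal) simp
  then have span: "UNIV \<subseteq> vec.span ?B" unfolding vec.span_Basis .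
  have "card ?S \<le> CARD('n) - 1"
    using card_image_le[of "UNIV - {j}" u] by (simp add: card_Diff_singleton)
  moreover have n: "CARD('n) \<ge> 1" by (simp add: Suc_leI)
  ultimately have le: "card ?B \<le> CARD('n)"
    using card_insert_le_m1[of "CARD('n)" ?S "axis j 1"] by simp
  have dim: "vec.dim (UNIV :: (rat^'n) set) = CARD('n)" by (simp add: vec.dim_UNIV card_cart_basis)
  have ind: "vec.independent ?B"
    by (rule vec.card_le_dim_spanning[OF subset_UNIV span]) (use le dim in auto)
  have "CARD('n) \<le> card ?B" using vec.dim_le_card[OF span] dim by simp
  also have "card ?B \<le> Suc (card ?S)" by (rule card_insert_le_m1[THEN order_trans]) auto
  finally have "d \<le> card ?S" using d by linarith
  then obtain T where T: "T \<subseteq> ?S" "card T = d" using obtain_subset_with_card_n by metis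
  have "vec.independent T" using ind T(1) by (meson subset_insertI2 vec.independent_mono)
  then have Gr: "vec.span T \<in> Gr d"
    using T(2) by (simp add: Gr_def vec.dim_eq_card_independent)
  let ?dot = "\<lambda>x. \<Sum>i\<in>UNIV. rat_of_int (k $ i) * x $ i"
  have dot_u: "?dot (u i) = 0" for i
  proof -
    have axis: "?dot (axis l 1) = rat_of_int (k $ l)" for l
      by (simp add: axis_def if_distrib[of "(*) _"] cong: if_cong)
    have "?dot (u i) = ?dot (axis i 1) - c i * ?dot (axis j 1)"
      by (simp add: u_def right_diff_distrib sum_subtractf sum_distrib_left mult_ac)
    also have "\<dots> = 0" unfolding axis using j by (cases "k = 0") (auto simp: c_def)
    finally show ?thesis .
  qed
  have "?dot x = 0" if "x \<in> vec.span T" for x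
    using that
  proof (induction rule: vec.span_induct_alt)
    case (step c y z)
    have "?dot (c *s y + z) = c * ?dot y + ?dot z"
      by (simp add: distrib_left sum.distrib sum_distrib_left mult_ac)
    then show ?case using step T(1) dot_u by auto
  qed simp
  then have "perp k (vec.span T)" by (simp add: perp_def)
  then show ?thesis using Gr by (auto simp: Omega_def)
qed

section \<open>The plane transform of a distribution\<close>

text \<open>
  Outside \<open>Gr d\<close> the chosen \<open>v\<close> is an arbitrary family of integer vectors; averages over their
  translates still map test functions to test functions.
\<close>

lemma radon_fun_eq_shift_avg:
  obtains v where "radon_fun d A = shift_avg (cube_measure {..<d}) (lattice_shift {..<d} (\<lambda>i. rvec (v i)))"
    "A \<in> Gr d \<Longrightarrow> integer_basis d A v"
proof
  let ?v = "SOME v. integer_basis d A v"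
  show "radon_fun d A = shift_avg (cube_measure {..<d}) (lattice_shift {..<d} (\<lambda>i. rvec (?v i)))"
    by (intro ext) (simp add: radon_fun_def Let_def shift_avg_def cube_measure_def integral_restrict_space cube_sets
        set_lebesgue_integral_def lattice_shift_def)
  show "integer_basis d A ?v" if "A \<in> Gr d"
    using integer_basis_exists[OF that] by (metis someI)
qed

lemma radon_distr_distribution:
  assumes u: "u \<in> distributions"
  shows "radon_distr d A u \<in> distributions"
proof -
  obtain v where v: "radon_fun d A = shift_avg (cube_measure {..<d}) (lattice_shift {..<d} (\<lambda>i. rvec (v i)))"
    using radon_fun_eq_shift_avg by metis
  interpret finite_measure "cube_measure {..<d}" by (rule finite_measure_cube) simp
  have test: "radon_fun d A f \<in> test_functions" if "f \<in> test_functions" for f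
    unfolding v by (rule shift_avg_test[OF that lattice_shift_measurable])
  have add: "radon_fun d A (\<lambda>x. f x + g x) = (\<lambda>x. radon_fun d A f x + radon_fun d A g x)"
    if "f \<in> test_functions" "g \<in> test_functions" for f g
    unfolding v by (rule shift_avg_add[OF that lattice_shift_measurable])
  have cmult: "radon_fun d A (\<lambda>x. c * f x) = (\<lambda>x. c * radon_fun d A f x)" for c f
    unfolding v by (rule shift_avg_cmult)
  obtain C N where C: "C \<ge> 0" "\<And>f. f \<in> test_functions \<Longrightarrow> cmod (u f) \<le> C * CN_norm N f"
    using distributions_bound[OF u] by metis
  have "cmod (u (radon_fun d A f)) \<le> C * CN_norm N f" if f: "f \<in> test_functions" for f
  proof -
    have "CN_norm N (radon_fun d A f) \<le> CN_norm N f"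
      unfolding v using shift_avg_CN_norm[OF f lattice_shift_measurable] measure_cube[of "{..<d}"] by simp
    then show ?thesis using C(2)[OF test[OF f]] mult_left_mono[OF _ C(1)] order_trans by blast
  qed
  then show ?thesis
    unfolding distributions_def radon_distr_def
    by (auto simp: test_add test_cmult add cmult test distributions_add[OF u] distributions_cmult[OF u])
qed

text \<open>
  By duality this is the value of the transform on a character.
\<close>

lemma fcoeff_radon_distr:
  assumes u: "u \<in> distributions" and A: "A \<in> Gr d"
  shows "fcoeff (radon_distr d A u) k = (if perp k A then fcoeff u k else 0)"
proof -
  obtain v where v: "radon_fun d A = shift_avg (cube_measure {..<d}) (lattice_shift {..<d} (\<lambda>i. rvec (v i)))"
    "integer_basis d A v"
    using radon_fun_eq_shift_avg A by metis
  have "(\<forall>i\<in>{..<d}. rvec (- k) \<bullet> rvec (v i) = 0) \<longleftrightarrow> perp k A"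
    by (auto simp: perp_iff_integer_basis[OF v(2)] rvec_minus)
  then have "radon_fun d A (chi (- k)) = (\<lambda>x. (if perp k A then 1 else 0) * chi (- k) x)"
    unfolding v(1) by (subst cube_avg_chi) auto
  then show ?thesis
    by (simp add: fcoeff_chi radon_distr_def chi_test distributions_cmult[OF u])
qed

section \<open>The weighted adjoint and the normal operator\<close>

locale radon_weight =
  fixes d :: nat and w :: "int^'n::finite \<Rightarrow> (rat^'n) set \<Rightarrow> real" and C :: real
  assumes d: "d \<le> CARD('n) - 1"
    and w_pos: "\<And>k A. A \<in> Gr d \<Longrightarrow> w k A > 0"
    and C: "C > 0"
    and w_summable: "\<And>k. (\<lambda>A. (w k A)\<^sup>2) summable_on Omega d k"
    and w_bound: "\<And>k. (\<Sum>\<^sub>\<infinity>A\<in>Omega d k. (w k A)\<^sup>2) \<le> C\<^sup>2"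
begin

lemma W_has_sum: "((\<lambda>A. (w k A)\<^sup>2) has_sum W d w k) (Omega d k)"
  unfolding W_def by (rule has_sum_infsum[OF w_summable])

lemma W_le: "W d w k \<le> C\<^sup>2"
  unfolding W_def by (rule w_bound)

lemma W_pos: "W d w k > 0"
proof -
  obtain A where A: "A \<in> Omega d k" using Omega_nonempty[OF d] by blast
  then have "A \<in> Gr d" by (simp add: Omega_def)
  then have "0 < (\<Sum>A\<in>{A}. (w k A)\<^sup>2)" using w_pos[of A k] by simp
  also have "\<dots> \<le> W d w k"
    unfolding W_def by (rule finite_sum_le_infsum[OF w_summable]) (use A in auto)
  finally show ?thesis .
qed

lemma radon_in_distributions: "u \<in> distributions \<Longrightarrow> radon d u \<in> Gr d \<rightarrow>\<^sub>E distributions"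
  by (auto simp: radon_def radon_distr_distribution)

lemma fcoeff_radon:
  "u \<in> distributions \<Longrightarrow> A \<in> Gr d \<Longrightarrow> fcoeff (radon d u A) k = (if perp k A then fcoeff u k else 0)"
  by (simp add: radon_def fcoeff_radon_distr)

lemma radon_star_radon_has_sum:
  assumes u: "u \<in> distributions"
  shows "((\<lambda>A. complex_of_real ((w k A)\<^sup>2) * fcoeff (radon d u A) k) has_sum
    complex_of_real (W d w k) * fcoeff u k) (Omega d k)"
proof -
  have "((\<lambda>A. complex_of_real ((w k A)\<^sup>2) * fcoeff u k) has_sum complex_of_real (W d w k) * fcoeff u k) (Omega d k)"
    by (intro has_sum_cmult_left has_sum_of_real W_has_sum)
  then show ?thesis
    by (rule has_sum_cong[THEN iffD1, rotated]) (auto simp: Omega_def fcoeff_radon[OF u])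
qed

text \<open>
  The sequence \<open>W\<^sub>k\<close> is bounded, so its product with the coefficients of \<open>u\<close> has polynomial growth.
\<close>

lemma radon_star_radon:
  assumes u: "u \<in> distributions"
  shows "radon_star d w (radon d u) \<in> distributions"
    and "fcoeff (radon_star d w (radon d u)) k = complex_of_real (W d w k) * fcoeff u k"
proof -
  obtain B N where B: "\<And>k. cmod (fcoeff u k) \<le> B * jbracket k ^ N"
    using fcoeff_poly_growth[OF u] by (auto simp: poly_growth_def)
  have "cmod (complex_of_real (W d w k) * fcoeff u k) \<le> (C\<^sup>2 * B) * jbracket k ^ N" for k
    unfolding norm_mult mult.assoc
    by (intro mult_mono B) (use W_le[of k] W_pos[of k] in auto)
  then have "poly_growth (\<lambda>k. complex_of_real (W d w k) * fcoeff u k)"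
    unfolding poly_growth_def by blast
  then obtain v where v: "v \<in> distributions" "\<And>k. fcoeff v k = complex_of_real (W d w k) * fcoeff u k"
    by (rule distribution_with_coefficients) blast
  then have "radon_star d w (radon d u) = v"
    using radon_star_radon_has_sum[OF u] by (intro radon_star_eqI) simp_all
  then show "radon_star d w (radon d u) \<in> distributions"
    "fcoeff (radon_star d w (radon d u)) k = complex_of_real (W d w k) * fcoeff u k"
    using v by auto
qed

lemma inversion:
  assumes u: "u \<in> distributions"
  shows "fourier_multiplier (\<lambda>k. complex_of_real (inverse (W d w k))) (radon_star d w (radon d u)) = u"
  by (rule fourier_multiplier_eqI[OF u]) (simp add: radon_star_radon[OF u] W_pos[THEN less_imp_neq, symmetric])

text \<open>
  Exchanges the order of the two indices of a sum that only sees incident pairs, so that the inner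
  summation runs over \<open>\<Omega>\<^sub>k\<close>.
\<close>

lemma has_sum_incidence:
  assumes "\<And>A k. A \<in> Gr d \<Longrightarrow> \<not> perp k A \<Longrightarrow> F (A, k) = 0"
  shows "(F has_sum S) (Gr d \<times> UNIV) \<longleftrightarrow> ((\<lambda>(k, A). F (A, k)) has_sum S) (SIGMA k:UNIV. Omega d k)"
proof -
  have "(F has_sum S) (Gr d \<times> UNIV) \<longleftrightarrow> (F has_sum S) (prod.swap ` (SIGMA k:UNIV. Omega d k))"
    by (rule has_sum_cong_neutral) (use assms in \<open>auto simp: Omega_def image_iff\<close>)
  also have "\<dots> \<longleftrightarrow> ((F \<circ> prod.swap) has_sum S) (SIGMA k:UNIV. Omega d k)"
    by (rule has_sum_reindex) (auto simp: inj_on_def)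
  also have "F \<circ> prod.swap = (\<lambda>(k, A). F (A, k))" by auto
  finally show ?thesis .
qed

text \<open>
  For fixed \<open>k\<close> the summation over \<open>\<Omega>\<^sub>k\<close> only meets the weight and gives \<open>W\<^sub>k\<close>, which is at most \<open>C\<^sup>2\<close>.
\<close>

lemma radon_L22:
  assumes f: "f \<in> sobolev s"
  shows "radon d f \<in> L22 d s w" and "L22_norm d s w (radon d f) \<le> C * sobolev_norm s f"
    and "(\<lambda>(k, A). (w k A)\<^sup>2 * jbracket k powr (2 * s) * (cmod (fcoeff f k))\<^sup>2) summable_on (SIGMA k:UNIV. Omega d k)"
proof -
  have u: "f \<in> distributions" using f by (simp add: sobolev_def)
  let ?a = "\<lambda>k. jbracket k powr (2 * s) * (cmod (fcoeff f k))\<^sup>2"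
  let ?F = "\<lambda>(A, k). (w k A)\<^sup>2 * jbracket k powr (2 * s) * (cmod (fcoeff (radon d f A) k))\<^sup>2"
  let ?G = "\<lambda>(k, A). (w k A)\<^sup>2 * jbracket k powr (2 * s) * (cmod (fcoeff f k))\<^sup>2"
  have a: "?a summable_on UNIV" using f by (simp add: sobolev_def)
  have inner: "((\<lambda>A. ?G (k, A)) has_sum W d w k * ?a k) (Omega d k)" for k
    using has_sum_cmult_left[OF W_has_sum[of k], of "?a k"] by (simp add: mult_ac)
  have Wa: "W d w k * ?a k \<le> C\<^sup>2 * ?a k" for k by (intro mult_right_mono W_le) auto
  have outer: "(\<lambda>k. W d w k * ?a k) summable_on UNIV"
    by (rule summable_on_comparison_test[OF summable_on_cmult_right[OF a] Wa])
      (intro mult_nonneg_nonneg less_imp_le[OF W_pos], auto)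
  show G: "?G summable_on (SIGMA k:UNIV. Omega d k)"
    by (rule summable_on_SigmaI[OF inner outer]) auto
  have "(?G has_sum (\<Sum>\<^sub>\<infinity>k. W d w k * ?a k)) (SIGMA k:UNIV. Omega d k)"
    by (rule has_sum_SigmaI[OF inner has_sum_infsum[OF outer] G])
  then have "((\<lambda>(k, A). ?F (A, k)) has_sum (\<Sum>\<^sub>\<infinity>k. W d w k * ?a k)) (SIGMA k:UNIV. Omega d k)"
    by (rule has_sum_cong[THEN iffD1, rotated]) (auto simp: Omega_def fcoeff_radon[OF u])
  then have F: "(?F has_sum (\<Sum>\<^sub>\<infinity>k. W d w k * ?a k)) (Gr d \<times> UNIV)"
    by (subst has_sum_incidence) (auto simp: fcoeff_radon[OF u])
  then show "radon d f \<in> L22 d s w"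
    using radon_in_distributions[OF u] has_sum_imp_summable by (auto simp: L22_def)
  have "(\<Sum>\<^sub>\<infinity>k. W d w k * ?a k) \<le> (\<Sum>\<^sub>\<infinity>k. C\<^sup>2 * ?a k)"
    by (intro infsum_mono outer summable_on_cmult_right a Wa)
  also have "\<dots> = C\<^sup>2 * (\<Sum>\<^sub>\<infinity>k. ?a k)" by (rule infsum_cmult_right')
  finally have "sqrt (\<Sum>\<^sub>\<infinity>k. W d w k * ?a k) \<le> sqrt (C\<^sup>2 * (\<Sum>\<^sub>\<infinity>k. ?a k))" by simp
  then show "L22_norm d s w (radon d f) \<le> C * sobolev_norm s f"
    using C unfolding L22_norm_def sobolev_norm_def infsumI[OF F] by (simp add: real_sqrt_mult)
qed

lemma L22_summable_incidence:
  assumes g: "g \<in> L22 d s w"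
  shows "(\<lambda>(k, A). (w k A)\<^sup>2 * jbracket k powr (2 * s) * (cmod (fcoeff (g A) k))\<^sup>2)
    summable_on (SIGMA k:UNIV. Omega d k)"
proof -
  let ?F = "\<lambda>(A, k). (w k A)\<^sup>2 * jbracket k powr (2 * s) * (cmod (fcoeff (g A) k))\<^sup>2"
  have "?F summable_on (Gr d \<times> UNIV)" using g by (simp add: L22_def)
  then have "?F summable_on (prod.swap ` (SIGMA k:UNIV. Omega d k))"
    by (rule summable_on_subset_banach) (auto simp: Omega_def)
  then have "(?F \<circ> prod.swap) summable_on (SIGMA k:UNIV. Omega d k)"
    by (subst (asm) summable_on_reindex) (auto simp: inj_on_def)
  moreover have "?F \<circ> prod.swap = (\<lambda>(k, A). (w k A)\<^sup>2 * jbracket k powr (2 * s) * (cmod (fcoeff (g A) k))\<^sup>2)"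
    by auto
  ultimately show ?thesis by simp
qed

text \<open>
  The inequality holds for finite partial sums, with \<open>w(k, A)\<^sup>2 z\<close> split as
  \<open>w(k, A) (w(k, A) z)\<close>, and passes to the limit.
\<close>

lemma weighted_Cauchy_Schwarz:
  fixes z :: "(rat^'n) set \<Rightarrow> complex"
  assumes z: "(\<lambda>A. (w k A)\<^sup>2 * (cmod (z A))\<^sup>2) summable_on Omega d k"
  shows "(\<lambda>A. complex_of_real ((w k A)\<^sup>2) * z A) summable_on Omega d k"
    and "(cmod (\<Sum>\<^sub>\<infinity>A\<in>Omega d k. complex_of_real ((w k A)\<^sup>2) * z A))\<^sup>2
      \<le> C\<^sup>2 * (\<Sum>\<^sub>\<infinity>A\<in>Omega d k. (w k A)\<^sup>2 * (cmod (z A))\<^sup>2)"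
proof -
  let ?z = "\<lambda>A. complex_of_real ((w k A)\<^sup>2) * z A"
  let ?P = "\<Sum>\<^sub>\<infinity>A\<in>Omega d k. (w k A)\<^sup>2 * (cmod (z A))\<^sup>2"
  have "(\<lambda>A. cmod (?z A)) summable_on Omega d k"
  proof (rule summable_on_comparison_test[OF summable_on_add[OF w_summable z]])
    fix A
    have "t \<le> 1 + t\<^sup>2" for t :: real
      using zero_le_power2[of "t - 1 / 2"] by (simp add: power2_eq_square algebra_simps)
    from mult_left_mono[OF this, of "(w k A)\<^sup>2" "cmod (z A)"]
    show "cmod (?z A) \<le> (w k A)\<^sup>2 + (w k A)\<^sup>2 * (cmod (z A))\<^sup>2"
      by (simp add: norm_mult norm_power distrib_left)
  qed simp
  then show sm: "?z summable_on Omega d k" by (rule abs_summable_summable)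
  have fin: "(cmod (sum ?z F))\<^sup>2 \<le> C\<^sup>2 * ?P" if F: "finite F" "F \<subseteq> Omega d k" for F
  proof -
    have "cmod (sum ?z F) \<le> (\<Sum>A\<in>F. \<bar>w k A\<bar> * (\<bar>w k A\<bar> * cmod (z A)))"
      by (rule sum_norm_le) (simp add: norm_mult norm_power power2_eq_square abs_mult[symmetric] flip: mult.assoc)
    then have "(cmod (sum ?z F))\<^sup>2 \<le> (\<Sum>A\<in>F. \<bar>w k A\<bar> * (\<bar>w k A\<bar> * cmod (z A)))\<^sup>2"
      by (intro power_mono) auto
    also have "\<dots> \<le> (\<Sum>A\<in>F. \<bar>w k A\<bar>\<^sup>2) * (\<Sum>A\<in>F. (\<bar>w k A\<bar> * cmod (z A))\<^sup>2)"
      by (rule Cauchy_Schwarz_ineq_sum)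
    also have "\<dots> = (\<Sum>A\<in>F. (w k A)\<^sup>2) * (\<Sum>A\<in>F. (w k A)\<^sup>2 * (cmod (z A))\<^sup>2)"
      by (simp add: power_mult_distrib)
    also have "\<dots> \<le> C\<^sup>2 * ?P"
    proof (intro mult_mono)
      show "(\<Sum>A\<in>F. (w k A)\<^sup>2) \<le> C\<^sup>2"
        by (rule order_trans[OF finite_sum_le_infsum[OF w_summable F] w_bound]) simp
      show "(\<Sum>A\<in>F. (w k A)\<^sup>2 * (cmod (z A))\<^sup>2) \<le> ?P"
        by (rule finite_sum_le_infsum[OF z F]) simp
    qed (auto intro!: sum_nonneg)
    finally show ?thesis .
  qed
  have "((\<lambda>F. (cmod (sum ?z F))\<^sup>2) \<longlongrightarrow> (cmod (infsum ?z (Omega d k)))\<^sup>2) (finite_subsets_at_top (Omega d k))"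
    using has_sum_infsum[OF sm] unfolding has_sum_def by (intro tendsto_intros)
  then show "(cmod (infsum ?z (Omega d k)))\<^sup>2 \<le> C\<^sup>2 * ?P"
  proof (rule tendsto_upperbound)
    show "\<forall>\<^sub>F F in finite_subsets_at_top (Omega d k). (cmod (sum ?z F))\<^sup>2 \<le> C\<^sup>2 * ?P"
      by (rule eventually_finite_subsets_at_top_weakI) (rule fin)
  qed simp
qed

text \<open>
  The candidate coefficients \<open>h\<close> satisfy the \<open>H\<^sup>s\<close> bound by Cauchy-Schwarz. In particular they have
  polynomial growth, so they are the coefficients of a distribution.
\<close>

lemma radon_star_L22:
  assumes g: "g \<in> L22 d s w"
  shows "radon_star d w g \<in> sobolev s"
    and "((\<lambda>A. complex_of_real ((w k A)\<^sup>2) * fcoeff (g A) k) has_sum fcoeff (radon_star d w g) k) (Omega d k)"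
proof -
  let ?G = "\<lambda>k A. (w k A)\<^sup>2 * jbracket k powr (2 * s) * (cmod (fcoeff (g A) k))\<^sup>2"
  let ?z = "\<lambda>k A. complex_of_real ((w k A)\<^sup>2) * fcoeff (g A) k"
  define h where "h k = infsum (?z k) (Omega d k)" for k
  define E where "E k = infsum (?G k) (Omega d k)" for k
  have J: "jbracket k powr (2 * s) > 0" for k :: "int^'n" using jbracket_ge_1[of k] by simp
  have G: "(\<lambda>(k, A). ?G k A) summable_on (SIGMA k:UNIV. Omega d k)"
    by (rule L22_summable_incidence[OF g])
  have Gk: "?G k summable_on Omega d k" for k
  proof -
    have "(\<lambda>(k, A). ?G k A) summable_on (Pair k ` Omega d k)"
      by (rule summable_on_subset_banach[OF G]) auto
    then show ?thesis by (subst (asm) summable_on_reindex) (auto simp: inj_on_def o_def)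
  qed
  have E: "E summable_on UNIV"
    unfolding E_def using summable_on_Sigma_banach[OF G] by simp
  have E0: "E k \<ge> 0" for k unfolding E_def by (intro infsum_nonneg) simp
  have zk: "(\<lambda>A. (w k A)\<^sup>2 * (cmod (fcoeff (g A) k))\<^sup>2) summable_on Omega d k"
    and Ek: "E k = jbracket k powr (2 * s) * (\<Sum>\<^sub>\<infinity>A\<in>Omega d k. (w k A)\<^sup>2 * (cmod (fcoeff (g A) k))\<^sup>2)" for k
  proof -
    have *: "?G k = (\<lambda>A. jbracket k powr (2 * s) * ((w k A)\<^sup>2 * (cmod (fcoeff (g A) k))\<^sup>2))"
      by (simp add: mult_ac)
    show "(\<lambda>A. (w k A)\<^sup>2 * (cmod (fcoeff (g A) k))\<^sup>2) summable_on Omega d k"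
      using Gk[of k] J[of k] unfolding * by (subst (asm) summable_on_cmult_right') auto
    show "E k = jbracket k powr (2 * s) * (\<Sum>\<^sub>\<infinity>A\<in>Omega d k. (w k A)\<^sup>2 * (cmod (fcoeff (g A) k))\<^sup>2)"
      unfolding E_def * by (rule infsum_cmult_right')
  qed
  have h: "(?z k has_sum h k) (Omega d k)" for k
    unfolding h_def by (rule has_sum_infsum[OF weighted_Cauchy_Schwarz(1)[OF zk]])
  have hE: "jbracket k powr (2 * s) * (cmod (h k))\<^sup>2 \<le> C\<^sup>2 * E k" for k
    using mult_left_mono[OF weighted_Cauchy_Schwarz(2)[OF zk], of "jbracket k powr (2 * s)" k]
    by (simp add: h_def Ek mult_ac)
  have "poly_growth h"
  proof -
    \<comment> \<open>An integer exponent for which the weight of order \<open>- 2 s\<close> is at most that of order \<open>2 N\<close>, for either sign of \<open>s\<close>.\<close>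
    define N where "N = nat \<lceil>\<bar>s\<bar>\<rceil>"
    define T where "T = infsum E UNIV"
    have "cmod (h k) \<le> (C * sqrt T) * jbracket k ^ N" for k
    proof (rule power2_le_imp_le)
      have T: "E k \<le> T"
        unfolding T_def using finite_sum_le_infsum[OF E, of "{k}"] E0 by simp
      have "(cmod (h k))\<^sup>2 = jbracket k powr (- 2 * s) * (jbracket k powr (2 * s) * (cmod (h k))\<^sup>2)"
        using jbracket_ge_1[of k] by (simp add: powr_minus)
      also have "\<dots> \<le> jbracket k powr (2 * real N) * (C\<^sup>2 * T)"
      proof (rule mult_mono)
        have "\<bar>s\<bar> \<le> real N" unfolding N_def by linarith
        then show "jbracket k powr (- 2 * s) \<le> jbracket k powr (2 * real N)"
          using jbracket_ge_1[of k] by (intro powr_mono) auto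
        show "jbracket k powr (2 * s) * (cmod (h k))\<^sup>2 \<le> C\<^sup>2 * T"
          by (rule order_trans[OF hE mult_left_mono[OF T]]) simp
      qed (use jbracket_ge_1[of k] in auto)
      also have "jbracket k powr (2 * real N) = (jbracket k ^ N)\<^sup>2"
        using jbracket_ge_1[of k] powr_realpow[of "jbracket k" "2 * N"] by (simp add: power_mult[symmetric] mult.commute)
      also have "(jbracket k ^ N)\<^sup>2 * (C\<^sup>2 * T) = (C * sqrt T * jbracket k ^ N)\<^sup>2"
        using order_trans[OF E0 T] by (simp add: power_mult_distrib)
      finally show "(cmod (h k))\<^sup>2 \<le> (C * sqrt T * jbracket k ^ N)\<^sup>2" .
      show "0 \<le> C * sqrt T * jbracket k ^ N"
        using C order_trans[OF E0 T] jbracket_nonneg[of k] by simp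
    qed
    then show ?thesis unfolding poly_growth_def by blast
  qed
  then obtain v where v: "v \<in> distributions" "\<And>k. fcoeff v k = h k"
    by (rule distribution_with_coefficients) blast
  have rs: "radon_star d w g = v"
    by (rule radon_star_eqI) (use v h in auto)
  show "(?z k has_sum fcoeff (radon_star d w g) k) (Omega d k)"
    using h v(2) rs by simp
  have "(\<lambda>k. jbracket k powr (2 * s) * (cmod (h k))\<^sup>2) summable_on UNIV"
    by (rule summable_on_comparison_test[OF summable_on_cmult_right[OF E] hE]) simp
  then show "radon_star d w g \<in> sobolev s"
    using v rs by (simp add: sobolev_def)
qed

text \<open>
  The double series is absolutely convergent, because each term is at most the sum of the
  corresponding terms of the two squared norms. Summation over \<open>A\<close> first turns it into the inner
  product with \<open>R\<^sub>d\<^sup>* g\<close>.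
\<close>

lemma radon_star_adjoint_identity:
  assumes f: "f \<in> sobolev s" and g: "g \<in> L22 d s w"
  shows "L22_inner d s w (radon d f) g = sobolev_inner s f (radon_star d w g)"
proof -
  have u: "f \<in> distributions" using f by (simp add: sobolev_def)
  let ?T = "\<lambda>(A, k). complex_of_real ((w k A)\<^sup>2 * jbracket k powr (2 * s)) *
        fcoeff (radon d f A) k * cnj (fcoeff (g A) k)"
  let ?S = "\<lambda>(k, A). complex_of_real ((w k A)\<^sup>2 * jbracket k powr (2 * s)) *
        fcoeff f k * cnj (fcoeff (g A) k)"
  have "(\<lambda>x. cmod (?S x)) summable_on (SIGMA k:UNIV. Omega d k)"
  proof (rule summable_on_comparison_test[OF summable_on_add[OF radon_L22(3)[OF f] L22_summable_incidence[OF g]]])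
    fix x :: "(int^'n) \<times> ((rat^'n) set)"
    obtain k A where x: "x = (k, A)" by fastforce
    have "a * b \<le> a\<^sup>2 + b\<^sup>2" for a b :: real
      using sum_squares_bound[of a b] add_nonneg_nonneg[OF zero_le_power2[of a] zero_le_power2[of b]]
      unfolding mult.assoc by linarith
    from mult_left_mono[OF this, of "(w k A)\<^sup>2 * jbracket k powr (2 * s)" "cmod (fcoeff f k)" "cmod (fcoeff (g A) k)"]
    show "cmod (?S x) \<le> (case x of (k, A) \<Rightarrow> (w k A)\<^sup>2 * jbracket k powr (2 * s) * (cmod (fcoeff f k))\<^sup>2) +
        (case x of (k, A) \<Rightarrow> (w k A)\<^sup>2 * jbracket k powr (2 * s) * (cmod (fcoeff (g A) k))\<^sup>2)"
      by (simp add: x norm_mult norm_power distrib_left mult.assoc)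
  qed simp
  then obtain I where I: "(?S has_sum I) (SIGMA k:UNIV. Omega d k)"
    using abs_summable_summable has_sum_infsum by blast
  then have "((\<lambda>(k, A). ?T (A, k)) has_sum I) (SIGMA k:UNIV. Omega d k)"
    by (rule has_sum_cong[THEN iffD1, rotated]) (auto simp: Omega_def fcoeff_radon[OF u])
  then have "(?T has_sum I) (Gr d \<times> UNIV)"
    by (subst has_sum_incidence) (auto simp: fcoeff_radon[OF u])
  then have 1: "L22_inner d s w (radon d f) g = I"
    unfolding L22_inner_def by (rule infsumI)
  have "((\<lambda>A. ?S (k, A)) has_sum complex_of_real (jbracket k powr (2 * s)) * fcoeff f k *
      cnj (fcoeff (radon_star d w g) k)) (Omega d k)" for k
  proof -
    have "((\<lambda>A. cnj (complex_of_real ((w k A)\<^sup>2) * fcoeff (g A) k)) has_sum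
        cnj (fcoeff (radon_star d w g) k)) (Omega d k)"
      using radon_star_L22(2)[OF g, of k] by (subst has_sum_cnj_iff)
    from has_sum_cmult_right[OF this, of "complex_of_real (jbracket k powr (2 * s)) * fcoeff f k"]
    show ?thesis by (simp add: mult_ac)
  qed
  from has_sum_SigmaD[OF I this] have 2: "sobolev_inner s f (radon_star d w g) = I"
    unfolding sobolev_inner_def by (rule infsumI)
  show ?thesis using 1 2 by simp
qed

end

text \<open>
  The distribution with a single nonzero Fourier coefficient, at \<open>j\<close>, reads off the \<open>j\<close>-th
  coefficient of the other argument.
\<close>

lemma sobolev_inner_eqD:
  assumes h: "h \<in> distributions" and h': "h' \<in> distributions"
    and eq: "\<And>f. f \<in> sobolev s \<Longrightarrow> sobolev_inner s f h = sobolev_inner s f h'"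
  shows "h = h'"
proof (rule distribution_eqI[OF h h'])
  fix j :: "int^'a"
  have "poly_growth (\<lambda>k. if k = j then 1 else 0)"
    unfolding poly_growth_def by (rule exI[of _ 1], rule exI[of _ 0]) auto
  then obtain e where e: "e \<in> distributions" "\<And>k. fcoeff e k = (if k = j then 1 else 0)"
    by (rule distribution_with_coefficients) blast
  have "(\<lambda>k. jbracket k powr (2 * s) * (cmod (fcoeff e k))\<^sup>2) summable_on {j}" by simp
  then have "(\<lambda>k. jbracket k powr (2 * s) * (cmod (fcoeff e k))\<^sup>2) summable_on UNIV"
    by (rule summable_on_cong_neutral[THEN iffD1, rotated -1]) (auto simp: e(2))
  then have es: "e \<in> sobolev s" using e(1) by (simp add: sobolev_def)
  have inner: "sobolev_inner s e v = complex_of_real (jbracket j powr (2 * s)) * cnj (fcoeff v j)" for v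
  proof -
    have "sobolev_inner s e v = (\<Sum>\<^sub>\<infinity>k\<in>{j}. complex_of_real (jbracket k powr (2 * s)) * fcoeff e k * cnj (fcoeff v k))"
      unfolding sobolev_inner_def by (rule infsum_cong_neutral) (auto simp: e(2))
    then show ?thesis by (simp add: e(2))
  qed
  have "jbracket j powr (2 * s) \<noteq> 0" using jbracket_ge_1[of j] by simp
  then show "fcoeff h j = fcoeff h' j" using eq[OF es] by (simp add: inner)
qed

lemma (in radon_weight) is_adjoint_radon_star:
  "is_adjoint (sobolev s) (sobolev_inner s) (L22 d s w) (L22_inner d s w) (radon d) (radon_star d w)"
  unfolding is_adjoint_def
proof (intro conjI ballI allI iffI)
  show "radon d \<in> sobolev s \<rightarrow> L22 d s w" using radon_L22(1) by blast
next
  fix g h assume g: "g \<in> L22 d s w"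
    and h: "h \<in> sobolev s \<and> (\<forall>f\<in>sobolev s. L22_inner d s w (radon d f) g = sobolev_inner s f h)"
  have "radon_star d w g \<in> sobolev s" by (rule radon_star_L22(1)[OF g])
  then show "h = radon_star d w g"
    using h radon_star_adjoint_identity[OF _ g] by (intro sobolev_inner_eqD[of _ _ s]) (auto simp: sobolev_def)
next
  fix g h assume g: "g \<in> L22 d s w" and h: "h = radon_star d w g"
  show "h \<in> sobolev s" by (simp add: h radon_star_L22(1)[OF g])
  show "L22_inner d s w (radon d f) g = sobolev_inner s f h" if "f \<in> sobolev s" for f
    unfolding h by (rule radon_star_adjoint_identity[OF that g])
qed

theorem theorem4p9:
  fixes d :: nat and s C\<^sub>w :: real
    and w :: "int^'n::finite \<Rightarrow> (rat^'n) set \<Rightarrow> real"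
  assumes "CARD('n) \<ge> 2" and "1 \<le> d" and "d \<le> CARD('n) - 1"
    and "\<And>k A. A \<in> Gr d \<Longrightarrow> w k A > 0"
    and "\<And>A. A \<in> Gr d \<Longrightarrow> poly_decay (\<lambda>k. w k A)"
    and "C\<^sub>w > 0"
    and "\<And>k. (\<lambda>A. (w k A)\<^sup>2) summable_on Omega d k"
    and "\<And>k. (\<Sum>\<^sub>\<infinity>A\<in>Omega d k. (w k A)\<^sup>2) \<le> C\<^sub>w\<^sup>2"
  shows
    "radon d \<in> sobolev s \<rightarrow> L22 d s w \<and>
     (\<exists>B. \<forall>f\<in>sobolev s. L22_norm d s w (radon d f) \<le> B * sobolev_norm s f) \<and>
     is_adjoint (sobolev s) (sobolev_inner s) (L22 d s w) (L22_inner d s w)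
       (radon d) (radon_star d w) \<and>
     (\<forall>g\<in>L22 d s w. \<forall>k.
        ((\<lambda>A. complex_of_real ((w k A)\<^sup>2) * fcoeff (g A) k)
           has_sum fcoeff (radon_star d w g) k) (Omega d k)) \<and>
     (\<forall>f\<in>sobolev s. radon_star d w (radon d f) \<in> sobolev s \<and>
        radon_star d w (radon d f) = fourier_multiplier (\<lambda>k. complex_of_real (W d w k)) f \<and>
        (\<forall>k. fcoeff (radon_star d w (radon d f)) k = complex_of_real (W d w k) * fcoeff f k)) \<and>
     (\<forall>k. W d w k > 0) \<and>
     (\<forall>g\<in>radon d ` distributions.
        radon_star d w g \<in> distributions \<and>
        (\<forall>k. ((\<lambda>A. complex_of_real ((w k A)\<^sup>2) * fcoeff (g A) k)
                has_sum fcoeff (radon_star d w g) k) (Omega d k)) \<and>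
        fourier_multiplier (\<lambda>k. complex_of_real (inverse (W d w k))) (radon_star d w g)
          \<in> distributions \<and>
        (\<forall>k. fcoeff (fourier_multiplier (\<lambda>k. complex_of_real (inverse (W d w k)))
                        (radon_star d w g)) k
              = complex_of_real (inverse (W d w k)) * fcoeff (radon_star d w g) k) \<and>
        radon d (fourier_multiplier (\<lambda>k. complex_of_real (inverse (W d w k)))
                   (radon_star d w g)) = g) \<and>
     (\<forall>f\<in>distributions.
        fourier_multiplier (\<lambda>k. complex_of_real (inverse (W d w k)))
          (radon_star d w (radon d f)) = f)"
proof -
  interpret radon_weight d w C\<^sub>w
    by unfold_locales (use assms in auto)
  have sd: "f \<in> distributions" if "f \<in> sobolev s" for f :: "'n distr"
    using that by (simp add: sobolev_def)
  let ?M = "fourier_multiplier (\<lambda>k. complex_of_real (inverse (W d w k)))"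
  show ?thesis
  proof (intro conjI ballI allI)
    show "radon d \<in> sobolev s \<rightarrow> L22 d s w" using radon_L22(1) by blast
    show "\<exists>B. \<forall>f\<in>sobolev s. L22_norm d s w (radon d f) \<le> B * sobolev_norm s f"
      using radon_L22(2) by blast
    show "is_adjoint (sobolev s) (sobolev_inner s) (L22 d s w) (L22_inner d s w) (radon d) (radon_star d w)"
      by (rule is_adjoint_radon_star)
    show "((\<lambda>A. complex_of_real ((w k A)\<^sup>2) * fcoeff (g A) k) has_sum fcoeff (radon_star d w g) k) (Omega d k)"
      if "g \<in> L22 d s w" for g k by (rule radon_star_L22(2)[OF that])
    show "W d w k > 0" for k by (rule W_pos)
  next
    fix f :: "'n distr" assume f: "f \<in> sobolev s"
    show "radon_star d w (radon d f) \<in> sobolev s"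
      by (rule radon_star_L22(1)[OF radon_L22(1)[OF f]])
    show "radon_star d w (radon d f) = fourier_multiplier (\<lambda>k. complex_of_real (W d w k)) f"
      by (rule fourier_multiplier_eqI[symmetric]) (use radon_star_radon[OF sd[OF f]] in auto)
    show "fcoeff (radon_star d w (radon d f)) k = complex_of_real (W d w k) * fcoeff f k" for k
      by (rule radon_star_radon(2)[OF sd[OF f]])
  next
    fix g :: "(rat^'n) set \<Rightarrow> 'n distr" assume "g \<in> radon d ` distributions"
    then obtain u where u: "u \<in> distributions" and g: "g = radon d u" by blast
    show "radon_star d w g \<in> distributions" by (simp add: g radon_star_radon[OF u])
    show "((\<lambda>A. complex_of_real ((w k A)\<^sup>2) * fcoeff (g A) k) has_sum fcoeff (radon_star d w g) k) (Omega d k)" for k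
      unfolding g radon_star_radon(2)[OF u] by (rule radon_star_radon_has_sum[OF u])
    show "?M (radon_star d w g) \<in> distributions" by (simp only: g inversion[OF u] u)
    show "fcoeff (?M (radon_star d w g)) k = complex_of_real (inverse (W d w k)) * fcoeff (radon_star d w g) k" for k
      unfolding g inversion[OF u] radon_star_radon(2)[OF u] using W_pos[of k] by simp
    show "radon d (?M (radon_star d w g)) = g" by (simp only: g inversion[OF u])
  next
    show "?M (radon_star d w (radon d f)) = f" if "f \<in> distributions" for f
      by (rule inversion[OF that])
  qed
qed

end
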